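(* Let $\mathcal U,\mathcal V,\mathcal X$ be real finite-dimensional Euclidean spaces, $f:\mathcal U\to(-\infty,+\infty]$ a closed proper convex function, $g(v)=\frac12\langle v,\Sigma_g v\rangle-\langle b,v\rangle$ with $\Sigma_g$ self-adjoint positive semidefinite on $\mathcal V$ and $b\in\mathcal V$, $\mathcal F:\mathcal X\to\mathcal U$, $\mathcal G:\mathcal X\to\mathcal V$ linear, $c\in\mathcal X$. Consider $$\text{(P)}\quad \min\{f(u)+g(v)\ :\ \mathcal F^*u+\mathcal G^*v=c\}$$ and its dual $$\text{(D)}\quad \min\{\langle c,x\rangle+f^*(s)+g^*(t)\ :\ \mathcal Fx+s=0,\ \mathcal Gx+t=0\}.$$ Let $\Sigma_f$ be a self-adjoint positive semidefinite operator on $\mathcal U$ such that $\langle\xi-\tilde\xi,u-\tilde u\rangle\ge\|u-\tilde u\|_{\Sigma_f}^2$ for all $u,\tilde u\in\mathrm{dom}f$, $\xi\in\partial f(u)$, $\tilde\xi\in\partial f(\tilde u)$. Let $\sigma>0$, $\tau\in(0,\infty)$; let $\mathcal E_g\succ0$ be self-adjoint on $\mathcal V$ with $\mathcal E_g\succeq\sigma^{-1}\Sigma_g+\mathcal G\mathcal G^*$, $\mathcal T_g:=\mathcal E_g-\sigma^{-1}\Sigma_g-\mathcal G\mathcal G^*$, let $\mathcal T_f\succeq0$ be self-adjoint on $\mathcal U$ and $\widehat{\mathcal T}_f:=\mathcal T_f+\mathcal F\mathcal G^*\mathcal E_g^{-1}\mathcal G\mathcal F^*$. Let $\mathcal L_\sigma(u,v;x)=f(u)+g(v)+\langle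 x,\mathcal F^*u+\mathcal G^*v-c\rangle+\frac\sigma2\|\mathcal F^*u+\mathcal G^*v-c\|^2$. Algorithm SCB-SPALM: choose $(u^0,v^0,x^0)\in\mathrm{dom}f\times\mathcal V\times\mathcal X$ and for $k=0,1,\dots$ set $$(u^{k+1},v^{k+1})=\operatorname{argmin}_{u,v}\ \mathcal L_\sigma(u,v;x^k)+\tfrac\sigma2\|u-u^k\|^2_{\widehat{\mathcal T}_f}+\tfrac\sigma2\|v-v^k\|^2_{\mathcal T_g},\qquad x^{k+1}=x^k+\tau\sigma(\mathcal F^*u^{k+1}+\mathcal G^*v^{k+1}-c).$$ Suppose the solution set of (P) is nonempty, that there exists $(\hat u,\hat v)\in\mathrm{ri}(\mathrm{dom}f)\times\mathcal V$ with $\mathcal F^*\hat u+\mathcal G^*\hat v=c$, and that $\mathcal T_f$ is chosen such that the sequence $\{(u^k,v^k,x^k)\}$ generated by SCB-SPALM is well defined. Assume either (a) $\tau\in(0,2)$, or (b) $\tau\ge2$ and $\sum_{k=0}^\infty\|\mathcal F^*u^{k+1}+\mathcal G^*v^{k+1}-c\|^2<\infty$. Then: (i) if $(u^\infty,v^\infty,x^\infty)$ is an accumulation point of $\{(u^k,v^k,x^k)\}$, then $(u^\infty,v^\infty)$ solves (P) and $x^\infty$ solves (D) (i.e. $(x^\infty,-\mathcal Fx^\infty,-\mathcal Gx^\infty)$ is optimal for (D)); (ii) if $\sigma^{-1}\Sigma_f+\mathcal T_f+\mathcal F\mathcal F^*\succ0$, then the sequence $\{(u^k,v^k,x^k)\}$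 is automatically well defined and converges to a unique limit $(u^\infty,v^\infty,x^\infty)$ with $(u^\infty,v^\infty)$ solving (P) and $x^\infty$ solving (D).
   Context: $\|w\|_{\mathcal T}^2:=\langle w,\mathcal T w\rangle$ for a self-adjoint positive semidefinite $\mathcal T$; $f^*,g^*$ are Fenchel conjugates; $\mathrm{ri}$ denotes relative interior; $\succ0$/$\succeq0$ denote positive definite/semidefinite. *)

theory Defs
  imports "HOL-Analysis.Analysis"
begin

definition edom :: "('a \<Rightarrow> ereal) \<Rightarrow> 'a set" where
  "edom f = {u. f u < \<infinity>}"

definition eepigraph :: "('a \<Rightarrow> ereal) \<Rightarrow> ('a \<times> real) set" where
  "eepigraph f = {(u, r). f u \<le> ereal r}"

definition proper_fun :: "('a \<Rightarrow> ereal) \<Rightarrow> bool" where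
  "proper_fun f \<longleftrightarrow> (\<forall>u. f u \<noteq> -\<infinity>) \<and> (\<exists>u. f u \<noteq> \<infinity>)"

definition closed_proper_convex :: "('a::real_normed_vector \<Rightarrow> ereal) \<Rightarrow> bool" where
  "closed_proper_convex f \<longleftrightarrow> proper_fun f \<and> convex (eepigraph f) \<and> closed (eepigraph f)"

definition subdiff :: "('a::real_inner \<Rightarrow> ereal) \<Rightarrow> 'a \<Rightarrow> 'a set" where
  "subdiff f u = {\<xi>. \<forall>y. f u + ereal (\<xi> \<bullet> (y - u)) \<le> f y}"

definition fconj :: "('a::real_inner \<Rightarrow> ereal) \<Rightarrow> 'a \<Rightarrow> ereal" where
  "fconj f s = (SUP u. ereal (s \<bullet> u) - f u)"

definition qnorm :: "('a::real_inner \<Rightarrow> 'a) \<Rightarrow> 'a \<Rightarrow> real" where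
  "qnorm T w = w \<bullet> T w"

definition self_adjoint :: "('a::euclidean_space \<Rightarrow> 'a) \<Rightarrow> bool" where
  "self_adjoint T \<longleftrightarrow> linear T \<and> adjoint T = T"

definition psd_op :: "('a::euclidean_space \<Rightarrow> 'a) \<Rightarrow> bool" where
  "psd_op T \<longleftrightarrow> self_adjoint T \<and> (\<forall>w. 0 \<le> w \<bullet> T w)"

definition pd_op :: "('a::euclidean_space \<Rightarrow> 'a) \<Rightarrow> bool" where
  "pd_op T \<longleftrightarrow> self_adjoint T \<and> (\<forall>w. w \<noteq> 0 \<longrightarrow> 0 < w \<bullet> T w)"

definition quad_fun :: "('v::real_inner \<Rightarrow> 'v) \<Rightarrow> 'v \<Rightarrow> 'v \<Rightarrow> real" where
  "quad_fun Sg b v = 1/2 * (v \<bullet> Sg v) - b \<bullet> v"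

definition P_feasible :: "('x::euclidean_space \<Rightarrow> 'u::euclidean_space) \<Rightarrow> ('x \<Rightarrow> 'v::euclidean_space)
    \<Rightarrow> 'x \<Rightarrow> 'u \<Rightarrow> 'v \<Rightarrow> bool" where
  "P_feasible F G c u v \<longleftrightarrow> adjoint F u + adjoint G v = c"

definition solves_P :: "('u::euclidean_space \<Rightarrow> ereal) \<Rightarrow> ('v::euclidean_space \<Rightarrow> real)
    \<Rightarrow> ('x::euclidean_space \<Rightarrow> 'u) \<Rightarrow> ('x \<Rightarrow> 'v) \<Rightarrow> 'x \<Rightarrow> 'u \<Rightarrow> 'v \<Rightarrow> bool" where
  "solves_P f g F G c u v \<longleftrightarrow> P_feasible F G c u v \<and>
     (\<forall>u' v'. P_feasible F G c u' v' \<longrightarrow> f u + ereal (g v) \<le> f u' + ereal (g v'))"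

definition D_obj :: "('u::euclidean_space \<Rightarrow> ereal) \<Rightarrow> ('v::euclidean_space \<Rightarrow> real)
    \<Rightarrow> 'x::euclidean_space \<Rightarrow> 'x \<Rightarrow> 'u \<Rightarrow> 'v \<Rightarrow> ereal" where
  "D_obj f g c x s t = ereal (c \<bullet> x) + fconj f s + fconj (\<lambda>v. ereal (g v)) t"

definition D_feasible :: "('x::euclidean_space \<Rightarrow> 'u::euclidean_space) \<Rightarrow> ('x \<Rightarrow> 'v::euclidean_space)
    \<Rightarrow> 'x \<Rightarrow> 'u \<Rightarrow> 'v \<Rightarrow> bool" where
  "D_feasible F G x s t \<longleftrightarrow> F x + s = 0 \<and> G x + t = 0"

definition solves_D_triple :: "('u::euclidean_space \<Rightarrow> ereal) \<Rightarrow> ('v::euclidean_space \<Rightarrow> real)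
    \<Rightarrow> ('x::euclidean_space \<Rightarrow> 'u) \<Rightarrow> ('x \<Rightarrow> 'v) \<Rightarrow> 'x \<Rightarrow> 'x \<Rightarrow> 'u \<Rightarrow> 'v \<Rightarrow> bool" where
  "solves_D_triple f g F G c x s t \<longleftrightarrow> D_feasible F G x s t \<and>
     (\<forall>x' s' t'. D_feasible F G x' s' t' \<longrightarrow> D_obj f g c x s t \<le> D_obj f g c x' s' t')"

definition solves_D :: "('u::euclidean_space \<Rightarrow> ereal) \<Rightarrow> ('v::euclidean_space \<Rightarrow> real)
    \<Rightarrow> ('x::euclidean_space \<Rightarrow> 'u) \<Rightarrow> ('x \<Rightarrow> 'v) \<Rightarrow> 'x \<Rightarrow> 'x \<Rightarrow> bool" where
  "solves_D f g F G c x \<longleftrightarrow> solves_D_triple f g F G c x (- F x) (- G x)"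

definition aug_lag :: "('u::euclidean_space \<Rightarrow> ereal) \<Rightarrow> ('v::euclidean_space \<Rightarrow> real)
    \<Rightarrow> ('x::euclidean_space \<Rightarrow> 'u) \<Rightarrow> ('x \<Rightarrow> 'v) \<Rightarrow> 'x \<Rightarrow> real \<Rightarrow> 'u \<Rightarrow> 'v \<Rightarrow> 'x \<Rightarrow> ereal" where
  "aug_lag f g F G c \<sigma> u v x = f u + ereal (g v + x \<bullet> (adjoint F u + adjoint G v - c)
       + \<sigma> / 2 * (norm (adjoint F u + adjoint G v - c))\<^sup>2)"

definition spalm_sub :: "('u::euclidean_space \<Rightarrow> ereal) \<Rightarrow> ('v::euclidean_space \<Rightarrow> real)
    \<Rightarrow> ('x::euclidean_space \<Rightarrow> 'u) \<Rightarrow> ('x \<Rightarrow> 'v) \<Rightarrow> 'x \<Rightarrow> real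
    \<Rightarrow> ('u \<Rightarrow> 'u) \<Rightarrow> ('v \<Rightarrow> 'v) \<Rightarrow> 'u \<Rightarrow> 'v \<Rightarrow> 'x \<Rightarrow> 'u \<Rightarrow> 'v \<Rightarrow> ereal" where
  "spalm_sub f g F G c \<sigma> Thf Tg uk vk xk u v =
     aug_lag f g F G c \<sigma> u v xk + ereal (\<sigma> / 2 * qnorm Thf (u - uk) + \<sigma> / 2 * qnorm Tg (v - vk))"

definition spalm_argmin :: "('u::euclidean_space \<Rightarrow> ereal) \<Rightarrow> ('v::euclidean_space \<Rightarrow> real)
    \<Rightarrow> ('x::euclidean_space \<Rightarrow> 'u) \<Rightarrow> ('x \<Rightarrow> 'v) \<Rightarrow> 'x \<Rightarrow> real
    \<Rightarrow> ('u \<Rightarrow> 'u) \<Rightarrow> ('v \<Rightarrow> 'v) \<Rightarrow> 'u \<Rightarrow> 'v \<Rightarrow> 'x \<Rightarrow> 'u \<Rightarrow> 'v \<Rightarrow> bool" where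
  "spalm_argmin f g F G c \<sigma> Thf Tg uk vk xk u' v' \<longleftrightarrow>
     (\<forall>u v. spalm_sub f g F G c \<sigma> Thf Tg uk vk xk u' v' \<le> spalm_sub f g F G c \<sigma> Thf Tg uk vk xk u v)"

definition scb_spalm_seq :: "('u::euclidean_space \<Rightarrow> ereal) \<Rightarrow> ('v::euclidean_space \<Rightarrow> real)
    \<Rightarrow> ('x::euclidean_space \<Rightarrow> 'u) \<Rightarrow> ('x \<Rightarrow> 'v) \<Rightarrow> 'x \<Rightarrow> real \<Rightarrow> real
    \<Rightarrow> ('u \<Rightarrow> 'u) \<Rightarrow> ('v \<Rightarrow> 'v) \<Rightarrow> (nat \<Rightarrow> 'u) \<Rightarrow> (nat \<Rightarrow> 'v) \<Rightarrow> (nat \<Rightarrow> 'x) \<Rightarrow> bool" where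
  "scb_spalm_seq f g F G c \<sigma> \<tau> Thf Tg u v x \<longleftrightarrow>
     u 0 \<in> edom f \<and>
     (\<forall>k. spalm_argmin f g F G c \<sigma> Thf Tg (u k) (v k) (x k) (u (Suc k)) (v (Suc k)) \<and>
          x (Suc k) = x k + (\<tau> * \<sigma>) *\<^sub>R (adjoint F (u (Suc k)) + adjoint G (v (Suc k)) - c))"

end

theory Submission
  imports Defs
begin

text \<open>
  Each step of the algorithm is a semi-proximal augmented Lagrangian step in the joint variable
  \<open>(u, v)\<close> with positive semidefinite proximal terms. Testing its optimality conditions against a
  KKT triple gives quasi-Fejer monotonicity of the energy
  \<open>\<parallel>x - x\<^sub>b\<parallel>\<^sup>2 / (\<tau> \<sigma>) + \<sigma> (\<parallel>u - u\<^sub>b\<parallel>\<^sup>2 + \<parallel>v - v\<^sub>b\<parallel>\<^sup>2)\<close> in the proximal seminorms, hence the residuals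
  and the proximal increments vanish and every accumulation point is a KKT triple. Completing the
  square in \<open>v\<close> shows that positive definiteness of \<open>Sf/\<sigma> + Tf + F F\<^sup>*\<close> makes the joint curvature
  form of the subproblem positive definite. This yields unique solvability of the subproblems,
  boundedness of the iterates, and, applying the energy estimate at an accumulation point,
  convergence of the whole sequence.
\<close>

section \<open>Closed proper convex functions\<close>

text \<open>The energy sees \<open>u\<close> and \<open>v\<close> only through the seminorms of
  \<open>Thf\<close> and \<open>Tg\<close>, which may vanish in some directions, so by itself it
  bounds neither. The descent estimate supplies the missing directions: the residual and the
  \<open>Sf\<close> and \<open>Sg\<close> terms tend to zero, and together with the energy they
  dominate \<open>curv\<close>. The inverse of \<open>Eg\<close> appears in \<open>Thf\<close> for
  the sake of this form: it provides the square that absorbs the coupling of \<open>u\<close> and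
  \<open>v\<close>. The threshold 2 for \<tau> comes from the residual alone: the optimality
  conditions contribute its squared norm with weight 2\<sigma>, and the multiplier update uses up
  \<tau>\<sigma> of that. For solvability of the subproblems there is another obstacle: the
  curvature of \<open>f\<close> is known only through monotonicity of its subdifferential. It has to
  be turned into growth of function values, starting from a point that carries a
  subgradient.\<close>

lemma proper_edomE:
  assumes "proper_fun f" "u \<in> edom f"
  obtains a where "f u = ereal a"
  using assms by (cases "f u") (auto simp: proper_fun_def edom_def)

lemma eepigraphD_edom: "(u, r) \<in> eepigraph f \<Longrightarrow> u \<in> edom f"
  by (auto simp: eepigraph_def edom_def intro: le_less_trans)

lemma edom_eq_image:
  assumes "proper_fun f"
  shows "edom f = fst ` eepigraph f"
proof (intro set_eqI iffI)
  fix u assume "u \<in> edom f"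
  then obtain a where "f u = ereal a" using proper_edomE[OF assms] by blast
  then have "(u, a) \<in> eepigraph f" by (simp add: eepigraph_def)
  then show "u \<in> fst ` eepigraph f" by (metis fst_conv imageI)
next
  fix u assume "u \<in> fst ` eepigraph f"
  then show "u \<in> edom f" using eepigraphD_edom by (metis imageE prod.collapse)
qed

lemma edom_nonempty: "proper_fun f \<Longrightarrow> edom f \<noteq> {}"
  by (auto simp: proper_fun_def edom_def)

lemma convex_edom:
  assumes "proper_fun f" "convex (eepigraph f)"
  shows "convex (edom f)"
  unfolding edom_eq_image[OF assms(1)]
  by (rule convex_linear_image[OF linear_fst assms(2)])

lemma convex_eepigraphD:
  assumes "convex (eepigraph f)" "f u = ereal a" "f y = ereal b" "0 \<le> t" "t \<le> 1"
  shows "f ((1 - t) *\<^sub>R u + t *\<^sub>R y) \<le> ereal ((1 - t) * a + t * b)"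
proof -
  have "(1 - t) *\<^sub>R (u, a) + t *\<^sub>R (y, b) \<in> eepigraph f"
    using assms by (intro convexD_alt) (auto simp: eepigraph_def)
  then show ?thesis by (simp add: eepigraph_def)
qed

lemma subdiff_edom:
  assumes "proper_fun f" "\<xi> \<in> subdiff f u"
  shows "u \<in> edom f"
proof -
  obtain y where y: "f y \<noteq> \<infinity>" using assms(1) by (auto simp: proper_fun_def)
  have "f u + ereal (\<xi> \<bullet> (y - u)) \<le> f y" using assms(2) by (auto simp: subdiff_def)
  with y have "f u \<noteq> \<infinity>" by auto
  then show ?thesis by (simp add: edom_def)
qed

text \<open>For small \<open>t\<close> the linear term dominates. In the applications
  \<open>a\<close> is a directional derivative at a minimizer, or minus the squared norm of a
  gradient, which is thereby forced to vanish.\<close>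

lemma linear_le_quadratic_imp_nonneg:
  fixes a C :: real
  assumes "\<And>t. 0 < t \<Longrightarrow> t \<le> 1 \<Longrightarrow> 0 \<le> t * a + t\<^sup>2 * C"
  shows "0 \<le> a"
proof (rule ccontr)
  assume "\<not> 0 \<le> a"
  then have a: "a < 0" by simp
  \<comment> \<open>Chosen so that \<open>t * C\<close> is at most \<open>- a / 2\<close>; the
    summand 1 avoids division by zero when \<open>C\<close> is zero.\<close>
  define t where "t = min 1 (- a / (2 * (\<bar>C\<bar> + 1)))"
  have t: "0 < t" "t \<le> 1" using a by (auto simp: t_def intro!: divide_neg_pos)
  have "t * (\<bar>C\<bar> + 1) \<le> - a / 2"
  proof -
    have "t \<le> - a / (2 * (\<bar>C\<bar> + 1))" by (simp add: t_def)
    then show ?thesis by (simp add: field_simps)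
  qed
  moreover have "t * C \<le> t * (\<bar>C\<bar> + 1)" using t by (intro mult_left_mono) auto
  ultimately have "a + t * C < 0" using a by linarith
  then have "t * (a + t * C) < 0" using t by (simp add: mult_pos_neg)
  with assms[OF t] show False by (simp add: algebra_simps power2_eq_square)
qed

text \<open>Fermat's rule for a convex function plus a smooth one. Of \<open>h\<close> only the
  exact second-order expansion along rays from \<open>u\<close> enters; convexity of
  \<open>f\<close> bounds its increment along the segment by \<open>t\<close> times the full
  increment, and the quadratic term disappears as \<open>t\<close> tends to 0.\<close>

lemma minimizer_subdiff:
  fixes f :: "'a::real_inner \<Rightarrow> ereal"
  assumes f: "proper_fun f" "convex (eepigraph f)"
    and u: "u \<in> edom f"
    and min: "\<And>y. f u + ereal (h u) \<le> f y + ereal (h y)"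
    and h: "\<And>z t. h (u + t *\<^sub>R z) = h u + t * (d \<bullet> z) + t\<^sup>2 * C z"
  shows "- d \<in> subdiff f u"
proof -
  obtain a where a: "f u = ereal a" using proper_edomE[OF f(1) u] .
  have "f u + ereal (- d \<bullet> (y - u)) \<le> f y" for y
  proof (cases "f y = \<infinity>")
    case False
    then have "y \<in> edom f" by (simp add: edom_def)
    then obtain b where b: "f y = ereal b" using proper_edomE[OF f(1)] by blast
    have "0 \<le> b - a + d \<bullet> (y - u)"
    proof (rule linear_le_quadratic_imp_nonneg)
      fix t :: real assume t: "0 < t" "t \<le> 1"
      let ?y = "u + t *\<^sub>R (y - u)"
      have eq: "(1 - t) *\<^sub>R u + t *\<^sub>R y = ?y" by (simp add: algebra_simps)
      have "ereal (a + h u) \<le> f ?y + ereal (h ?y)" using min[of ?y] a by simp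
      also have "\<dots> \<le> ereal ((1 - t) * a + t * b) + ereal (h ?y)"
        using convex_eepigraphD[OF f(2) a b, of t] t eq by (intro add_right_mono) auto
      finally have "a + h u \<le> (1 - t) * a + t * b + h ?y" by simp
      then show "0 \<le> t * (b - a + d \<bullet> (y - u)) + t\<^sup>2 * C (y - u)"
        unfolding h by (simp add: algebra_simps)
    qed
    then show ?thesis using a b by (simp add: inner_diff_right)
  qed simp
  then show ?thesis by (simp add: subdiff_def)
qed

text \<open>For fixed \<open>y\<close> the subgradient inequality places a point over
  \<open>u k\<close> in the epigraph. These points converge, so closedness of the epigraph suffices
  and no convergence of the values \<open>f (u k)\<close> has to be shown.\<close>

lemma subdiff_closed:
  fixes f :: "'a::real_inner \<Rightarrow> ereal"
  assumes f: "proper_fun f" "closed (eepigraph f)"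
    and xi: "\<xi> \<longlonglongrightarrow> \<xi>'" and u: "u \<longlonglongrightarrow> u'" and s: "\<And>k::nat. \<xi> k \<in> subdiff f (u k)"
  shows "\<xi>' \<in> subdiff f u'"
proof -
  have "f u' + ereal (\<xi>' \<bullet> (y - u')) \<le> f y" for y
  proof (cases "f y = \<infinity>")
    case False
    then have "y \<in> edom f" by (simp add: edom_def)
    then obtain b where b: "f y = ereal b" using proper_edomE[OF f(1)] by blast
    have "(u k, b - \<xi> k \<bullet> (y - u k)) \<in> eepigraph f" for k
    proof -
      obtain a where a: "f (u k) = ereal a"
        using proper_edomE[OF f(1) subdiff_edom[OF f(1) s]] .
      have "f (u k) + ereal (\<xi> k \<bullet> (y - u k)) \<le> f y" using s by (auto simp: subdiff_def)
      then show ?thesis using a b by (simp add: eepigraph_def)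
    qed
    moreover have "(\<lambda>k. (u k, b - \<xi> k \<bullet> (y - u k))) \<longlonglongrightarrow> (u', b - \<xi>' \<bullet> (y - u'))"
      by (intro tendsto_intros xi u)
    ultimately have "(u', b - \<xi>' \<bullet> (y - u')) \<in> eepigraph f"
      using closed_sequentially[OF f(2), of "\<lambda>k. (u k, b - \<xi> k \<bullet> (y - u k))"] by blast
    then have le: "f u' \<le> ereal (b - \<xi>' \<bullet> (y - u'))" by (simp add: eepigraph_def)
    then have "f u' + ereal (\<xi>' \<bullet> (y - u'))
        \<le> ereal (b - \<xi>' \<bullet> (y - u')) + ereal (\<xi>' \<bullet> (y - u'))"
      by (rule add_right_mono)
    then show ?thesis using b by simp
  qed simp
  then show ?thesis by (simp add: subdiff_def)
qed

text \<open>The multiplier is the normal of a hyperplane that properly separates the origin from the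
  image of the epigraph under \<open>(w, r) \<mapsto> (A w - c, r - f w\<^sub>0)\<close>; the Slater point rules out a
  vertical hyperplane.\<close>

lemma lagrange_multiplier:
  fixes f :: "'a::euclidean_space \<Rightarrow> ereal" and A :: "'a \<Rightarrow> 'x::euclidean_space"
  assumes f: "proper_fun f" "convex (eepigraph f)" and A: "linear A"
    and what: "what \<in> rel_interior (edom f)" "A what = c"
    and w0: "A w0 = c" "\<And>w. A w = c \<Longrightarrow> f w0 \<le> f w"
  obtains x where "\<And>w. f w0 \<le> f w + ereal (x \<bullet> (A w - c))"
proof -
  have conD: "convex (edom f)" using convex_edom f by blast
  have "what \<in> edom f" using what rel_interior_subset by blast
  then have "f w0 < \<infinity>" using w0(2)[OF what(2)] by (auto simp: edom_def)
  then have "w0 \<in> edom f" by (simp add: edom_def)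
  then obtain p where p: "f w0 = ereal p" using proper_edomE[OF f(1)] by blast
  define C where "C = (\<lambda>z. z - (c, p)) ` (\<lambda>(w, r). (A w, r)) ` eepigraph f"
  have C: "(A w - c, r - p) \<in> C" if "f w \<le> ereal r" for w r
    using that by (force simp: C_def eepigraph_def image_iff)
  have CE: "\<exists>w r. z = (A w - c, r - p) \<and> f w \<le> ereal r" if "z \<in> C" for z
    using that by (force simp: C_def eepigraph_def)
  have lin: "linear (\<lambda>(w, r). (A w, r :: real))"
    using A by (intro linearI) (auto simp: linear_add linear_scale)
  have cC: "convex C"
    unfolding C_def by (intro convex_translation_subtract convex_linear_image[OF lin] f)
  have 0: "0 \<in> C" using C[of w0 p] p w0 by (simp add: zero_prod_def)
  have 1: "(0, 1) \<in> C" using C[of w0 "p + 1"] p w0 by simp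
  have ne: "C \<noteq> {}" using 0 by auto
  \<comment> \<open>Otherwise the segment from \<open>(0, 1)\<close> to the origin could be
    prolonged inside \<open>C\<close>, which would give a feasible point with value below the
    minimum \<open>p\<close>.\<close>
  have "0 \<notin> rel_interior C"
  proof
    assume "0 \<in> rel_interior C"
    then obtain e :: real where e: "e > 1" "(1 - e) *\<^sub>R (0, 1) + e *\<^sub>R 0 \<in> C"
      using convex_rel_interior_iff[OF cC ne] 1 by blast
    then obtain w r where "(0, 1 - e) = (A w - c, r - p)" "f w \<le> ereal r"
      using CE[OF e(2)] by auto
    then have "A w = c" "r < p" using e(1) by auto
    with w0(2)[of w] p \<open>f w \<le> ereal r\<close> have "ereal p \<le> ereal r" by (metis order_trans)
    with \<open>r < p\<close> show False by simp
  qed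
  from supporting_hyperplane_rel_boundary[OF cC 0 this]
  obtain a where "a \<noteq> 0" and age: "\<And>z. z \<in> C \<Longrightarrow> 0 \<le> a \<bullet> z"
    and agt: "\<And>z. z \<in> rel_interior C \<Longrightarrow> 0 < a \<bullet> z"
    by (metis inner_zero_right)
  obtain y \<eta> where a: "a = (y, \<eta>)" by (cases a)
  have ge: "0 \<le> y \<bullet> (A w - c) + \<eta> * (r - p)" if "f w \<le> ereal r" for w r
    using age[OF C[OF that]] a by simp
  have eta0: "0 \<le> \<eta>" using ge[of w0 "p + 1"] p w0 by simp
  \<comment> \<open>With a vertical hyperplane the functional is nonnegative on the domain and zero
    at the Slater point. Prolonging segments beyond that point reverses the sign, so the functional
    vanishes on the whole domain, against its strict positivity on the relative interior of
    \<open>C\<close>.\<close>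
  have "\<eta> \<noteq> 0"
  proof
    assume eta: "\<eta> = 0"
    have ge': "0 \<le> y \<bullet> (A w - c)" if w: "w \<in> edom f" for w
    proof -
      obtain b where "f w = ereal b" using proper_edomE[OF f(1) w] .
      then show ?thesis using ge[of w b] eta by simp
    qed
    have le': "y \<bullet> (A w - c) \<le> 0" if w: "w \<in> edom f" for w
    proof -
      obtain e where e: "e > 1" "(1 - e) *\<^sub>R w + e *\<^sub>R what \<in> edom f"
        using what(1) convex_rel_interior_iff[OF conD] w by blast
      have "A ((1 - e) *\<^sub>R w + e *\<^sub>R what) - c = (1 - e) *\<^sub>R (A w - c)"
        unfolding linear_add[OF A] linear_scale[OF A] what(2) by (simp add: algebra_simps)
      then have "0 \<le> (1 - e) * (y \<bullet> (A w - c))" using ge'[OF e(2)] by simp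
      then show ?thesis using e(1) by (simp add: zero_le_mult_iff)
    qed
    obtain z where z: "z \<in> rel_interior C" using rel_interior_eq_empty[OF cC] ne by blast
    then have "z \<in> C" using rel_interior_subset by blast
    then obtain w r where w: "z = (A w - c, r - p)" "f w \<le> ereal r" using CE by blast
    then have "w \<in> edom f" by (auto simp: edom_def intro: le_less_trans)
    moreover have "0 < y \<bullet> (A w - c)" using agt[OF z] w(1) a eta by simp
    ultimately show False using le'[of w] by simp
  qed
  with eta0 have eta: "\<eta> > 0" by simp
  show thesis
  proof (rule that)
    fix w
    show "f w0 \<le> f w + ereal ((y /\<^sub>R \<eta>) \<bullet> (A w - c))"
    proof (cases "f w = \<infinity>")
      case False
      then have "w \<in> edom f" by (simp add: edom_def)
      then obtain b where b: "f w = ereal b" using proper_edomE[OF f(1)] by blast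
      have "0 \<le> y \<bullet> (A w - c) + \<eta> * (b - p)" using ge b by simp
      then have "p \<le> b + y \<bullet> (A w - c) / \<eta>" using eta by (simp add: field_simps)
      then show ?thesis using b p by (simp add: divide_inverse mult.commute)
    qed simp
  qed
qed

text \<open>Minimize \<open>f\<close> under the constraint \<open>w = u\<close>: the point
  \<open>u\<close> is both the minimizer and the Slater point, and minus the multiplier is a
  subgradient.\<close>

lemma rel_interior_subdiff:
  fixes f :: "'a::euclidean_space \<Rightarrow> ereal"
  assumes f: "proper_fun f" "convex (eepigraph f)" and u: "u \<in> rel_interior (edom f)"
  shows "subdiff f u \<noteq> {}"
proof -
  obtain x where x: "\<And>w. f u \<le> f w + ereal (x \<bullet> (id w - u))"
    using lagrange_multiplier[OF f linear_id u, of u u] by auto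
  have "f u + ereal (- x \<bullet> (w - u)) \<le> f w" for w
  proof -
    have "f u + ereal (- x \<bullet> (w - u)) \<le> f w + ereal (x \<bullet> (id w - u)) + ereal (- x \<bullet> (w - u))"
      using x by (rule add_right_mono)
    then show ?thesis by (simp add: add.assoc)
  qed
  then have "- x \<in> subdiff f u" by (simp add: subdiff_def)
  then show ?thesis by blast
qed

text \<open>Strong monotonicity is exploited only once, at the midpoint, which lies in the relative
  interior and therefore carries a subgradient; this loses a factor 2 against the optimal
  constant 1/2.\<close>

lemma strongly_monotone_growth:
  fixes f :: "'a::euclidean_space \<Rightarrow> ereal"
  assumes f: "proper_fun f" "convex (eepigraph f)" and S: "linear S"
    and mono: "\<And>u1 u2 \<xi>1 \<xi>2. \<xi>1 \<in> subdiff f u1 \<Longrightarrow> \<xi>2 \<in> subdiff f u2 \<Longrightarrow>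
                 qnorm S (u1 - u2) \<le> (\<xi>1 - \<xi>2) \<bullet> (u1 - u2)"
    and u0: "u0 \<in> rel_interior (edom f)" and xi: "\<xi> \<in> subdiff f u0"
  shows "f u0 + ereal (\<xi> \<bullet> (u - u0) + qnorm S (u - u0) / 4) \<le> f u"
proof (cases "f u = \<infinity>")
  case False
  then have u: "u \<in> edom f" by (simp add: edom_def)
  define m where "m = u - (1/2) *\<^sub>R (u - u0)"
  have m: "m \<in> rel_interior (edom f)" unfolding m_def
    using rel_interior_convex_shrink[OF convex_edom[OF f] u0 u, of "1/2"] by simp
  \<comment> \<open>The two subgradient inequalities, from \<open>m\<close> to \<open>u\<close> and
    from \<open>u0\<close> to \<open>m\<close>, add up to the one at \<open>u0\<close> plus half of
    the pairing of \<open>\<zeta> - \<xi>\<close> with \<open>u - u0\<close>; monotonicity bounds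
    this surplus from below.\<close>
  obtain \<zeta> where z: "\<zeta> \<in> subdiff f m" using rel_interior_subdiff[OF f m] by blast
  obtain b where b: "f u = ereal b" using proper_edomE[OF f(1) u] .
  obtain q where q: "f m = ereal q" using proper_edomE[OF f(1) subdiff_edom[OF f(1) z]] .
  obtain a where a: "f u0 = ereal a" using proper_edomE[OF f(1) subdiff_edom[OF f(1) xi]] .
  have eq: "u - m = (1/2) *\<^sub>R (u - u0)" by (simp add: m_def)
  have eq': "m - u0 = (1/2) *\<^sub>R (u - u0)" by (simp add: m_def algebra_simps flip: scaleR_left_distrib)
  have "f m + ereal (\<zeta> \<bullet> (u - m)) \<le> f u" using z by (auto simp: subdiff_def)
  then have 1: "q + (\<zeta> \<bullet> (u - u0)) / 2 \<le> b" using q b by (simp add: eq)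
  have "f u0 + ereal (\<xi> \<bullet> (m - u0)) \<le> f m" using xi by (auto simp: subdiff_def)
  then have 2: "a + (\<xi> \<bullet> (u - u0)) / 2 \<le> q" using q a by (simp add: eq')
  have "qnorm S (m - u0) \<le> (\<zeta> - \<xi>) \<bullet> (m - u0)" using mono[OF z xi] .
  then have 3: "qnorm S (u - u0) / 4 \<le> (\<zeta> \<bullet> (u - u0) - \<xi> \<bullet> (u - u0)) / 2"
    by (simp add: eq' qnorm_def linear_scale[OF S] inner_diff_left)
  have "a + (\<xi> \<bullet> (u - u0) + qnorm S (u - u0) / 4) \<le> b"
    using 1 2 3 by (simp add: field_simps)
  then show ?thesis using a b by simp
qed simp

text \<open>The levels strictly above the infimum cut out compact sets with the finite intersection
  property, and a point common to all of them attains the infimum. Working with levels treats an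
  infimum of minus infinity like any other.\<close>

lemma argmin_exists_of_bounded_sublevels:
  fixes f :: "'a::euclidean_space \<Rightarrow> ereal"
  assumes cl: "closed (eepigraph f)" and w0: "f w0 < \<infinity>"
    and bdd: "\<And>M. bounded {w. f w \<le> ereal M}"
  obtains w where "\<And>y. f w \<le> f y"
proof -
  have closed_sub: "closed {w. f w \<le> ereal m}" for m
  proof -
    have "closed ((\<lambda>w. (w, m)) -` eepigraph f)"
      by (intro closed_vimage cl continuous_intros)
    then show ?thesis by (simp add: eepigraph_def vimage_def)
  qed
  have comp: "compact {w. f w \<le> ereal m}" for m
    using closed_sub bdd compact_eq_bounded_closed by blast
  define I where "I = (INF w. f w)"
  define K where "K = (\<lambda>m. {w. f w \<le> ereal m}) ` {m. I < ereal m}"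
  obtain M where M: "f w0 \<le> ereal M" using w0 by (cases "f w0") auto
  have fip: "{w. f w \<le> ereal M} \<inter> \<Inter>K' \<noteq> {}" if K': "finite K'" "K' \<subseteq> K" for K'
  proof -
    obtain J where J: "finite J" "J \<subseteq> {m. I < ereal m}" "K' = (\<lambda>m. {w. f w \<le> ereal m}) ` J"
      using finite_subset_image[OF K'[unfolded K_def]] by blast
    show ?thesis
    proof (cases "J = {}")
      case True
      then show ?thesis using M J by auto
    next
      case False
      define m where "m = Min J"
      have mJ: "m \<in> J" using False J by (simp add: m_def)
      then have "I < ereal m" using J by auto
      then obtain w where w: "f w < ereal m" unfolding I_def by (auto simp: INF_less_iff)
      have le: "m \<le> j" if "j \<in> J" for j using that J by (simp add: m_def)
      show ?thesis
      \<comment> \<open>If \<open>w\<close> misses the level \<open>M\<close>, then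
        \<open>w0\<close> has a smaller value than \<open>w\<close> and serves as the common point
        instead.\<close>
      proof (cases "f w \<le> ereal M")
        case True
        have "f w \<le> ereal j" if "j \<in> J" for j
          using le[OF that] w by (meson ereal_less_eq(3) less_imp_le order_trans)
        with True show ?thesis using J by auto
      next
        case False
        then have "f w0 < ereal m" using M w by (meson less_trans not_le order_le_less_trans)
        then have "f w0 \<le> ereal j" if "j \<in> J" for j
          using le[OF that] by (meson ereal_less_eq(3) less_imp_le order_trans)
        with M show ?thesis using J by auto
      qed
    qed
  qed
  have "{w. f w \<le> ereal M} \<inter> \<Inter>K \<noteq> {}"
    using compact_imp_fip[OF comp[of M], of K] fip closed_sub by (auto simp: K_def)
  then obtain w where w: "\<And>m. I < ereal m \<Longrightarrow> f w \<le> ereal m" by (auto simp: K_def)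
  have "f w \<le> I"
  proof (rule ccontr)
    assume "\<not> f w \<le> I"
    then obtain m where "I < ereal m" "ereal m < f w" using ereal_dense2[of I "f w"] by (auto simp: not_le)
    with w show False by force
  qed
  then have "f w \<le> f y" for y unfolding I_def by (meson INF_lower UNIV_I order_trans)
  then show thesis using that by blast
qed

text \<open>The constant is the minimum over the unit sphere, which is positive because compactness
  lets it be attained.\<close>

lemma pos_homogeneous_coercive:
  fixes Q :: "'a::euclidean_space \<Rightarrow> real"
  assumes cont: "continuous_on UNIV Q" and hom: "\<And>t w. Q (t *\<^sub>R w) = t\<^sup>2 * Q w"
    and pos: "\<And>w. w \<noteq> 0 \<Longrightarrow> 0 < Q w"
  obtains \<alpha> where "\<alpha> > 0" "\<And>w. \<alpha> * (norm w)\<^sup>2 \<le> Q w"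
proof -
  have "sphere (0::'a) 1 \<noteq> {}" by simp
  then obtain w0 where w0: "w0 \<in> sphere 0 1" "\<And>w. w \<in> sphere 0 1 \<Longrightarrow> Q w0 \<le> Q w"
    using continuous_attains_inf[OF compact_sphere _ continuous_on_subset[OF cont subset_UNIV]]
    by metis
  have "Q w0 * (norm w)\<^sup>2 \<le> Q w" for w
  proof (cases "w = 0")
    case True
    then show ?thesis using hom[of 0 w] by simp
  next
    case False
    have "Q w = (norm w)\<^sup>2 * Q (w /\<^sub>R norm w)" using False hom[of "norm w" "w /\<^sub>R norm w"] by simp
    moreover have "Q w0 \<le> Q (w /\<^sub>R norm w)" using False by (intro w0) simp
    ultimately show ?thesis by (simp add: mult.commute[of "Q w0"] mult_left_mono)
  qed
  moreover have "Q w0 > 0" using w0(1) by (intro pos) auto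
  ultimately show thesis using that by blast
qed

section \<open>Quadratic forms\<close>

lemma self_adjointI:
  assumes "linear T" "\<And>x y. T x \<bullet> y = x \<bullet> T y"
  shows "self_adjoint T"
  unfolding self_adjoint_def using assms adjoint_unique[of T T] by simp

lemma self_adjointD:
  assumes "self_adjoint T"
  shows "linear T" "T x \<bullet> y = x \<bullet> T y"
  using assms adjoint_works[of T x y] unfolding self_adjoint_def by simp_all

lemma psd_opD:
  assumes "psd_op T"
  shows "linear T" "T x \<bullet> y = x \<bullet> T y" "0 \<le> qnorm T x"
  using assms self_adjointD(1)[of T] self_adjointD(2)[of T x y] unfolding psd_op_def qnorm_def by simp_all

lemma qnorm_scaleR: "linear T \<Longrightarrow> qnorm T (t *\<^sub>R w) = t\<^sup>2 * qnorm T w"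
  by (simp add: qnorm_def linear_scale power2_eq_square)

lemma qnorm_add:
  assumes "psd_op T"
  shows "qnorm T (x + y) = qnorm T x + 2 * (y \<bullet> T x) + qnorm T y"
proof -
  have "x \<bullet> T y = y \<bullet> T x" using psd_opD(2)[OF assms] by (metis inner_commute)
  then show ?thesis using psd_opD(1)[OF assms] by (simp add: qnorm_def linear_add algebra_simps)
qed

lemma continuous_on_qnorm [continuous_intros]:
  fixes T :: "'a::euclidean_space \<Rightarrow> 'a"
  assumes "linear T" "continuous_on S h"
  shows "continuous_on S (\<lambda>w. qnorm T (h w))"
  unfolding qnorm_def
  by (rule continuous_on_inner[OF assms(2) bounded_linear.continuous_on[OF _ assms(2)]])
    (rule linear_conv_bounded_linear[THEN iffD1, OF assms(1)])

text \<open>Needed to pass to the limit: the energy makes \<open>qnorm T w\<close> vanish, while the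
  optimality conditions contain the vector \<open>T w\<close>.\<close>

lemma psd_norm_bound:
  assumes T: "psd_op T"
  obtains B where "B > 0" "\<And>w. (norm (T w))\<^sup>2 \<le> B * qnorm T w"
proof -
  obtain B where B: "B > 0" "\<And>x. norm (T x) \<le> B * norm x"
    using linear_bounded_pos[OF psd_opD(1)[OF T]] by blast
  have "(norm (T w))\<^sup>2 \<le> B * qnorm T w" for w
  proof -
    \<comment> \<open>nonnegativity of the form at \<open>w - B\<^sup>-\<^sup>1 T w\<close>\<close>
    define z where "z = T w"
    have "0 \<le> qnorm T (w + (- 1 / B) *\<^sub>R z)" using psd_opD(3)[OF T] .
    also have "\<dots> = qnorm T w - 2 / B * (norm z)\<^sup>2 + (1 / B)\<^sup>2 * qnorm T z"
      unfolding qnorm_add[OF T] qnorm_scaleR[OF psd_opD(1)[OF T]]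
      by (simp add: z_def power2_norm_eq_inner)
    also have "qnorm T z \<le> norm z * norm (T z)" unfolding qnorm_def by (rule norm_cauchy_schwarz)
    also have "\<dots> \<le> norm z * (B * norm z)" by (intro mult_left_mono B) simp
    finally have "0 \<le> qnorm T w - 2 / B * (norm z)\<^sup>2 + (1 / B)\<^sup>2 * (norm z * (B * norm z))"
      by (simp add: mult_left_mono)
    also have "\<dots> = qnorm T w - (norm z)\<^sup>2 / B" using B(1)
      by (simp add: field_simps power2_eq_square)
    finally show ?thesis using B(1) by (simp add: z_def field_simps)
  qed
  then show thesis using B that by blast
qed

lemma quad_fun_add:
  assumes "psd_op S"
  shows "quad_fun S b (v + z) = quad_fun S b v + z \<bullet> (S v - b) + qnorm S z / 2"
  using qnorm_add[OF assms, of v z]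
  by (simp add: quad_fun_def qnorm_def inner_diff_right inner_add_right inner_commute)

text \<open>Turns the cross term produced by a proximal step into a difference of energies that
  telescopes over the iteration.\<close>

lemma qnorm_three_point:
  assumes "psd_op T"
  shows "2 * ((u1 - w) \<bullet> T (u1 - u0)) = qnorm T (u1 - w) + qnorm T (u1 - u0) - qnorm T (u0 - w)"
proof -
  have "qnorm T ((u1 - u0) + (u0 - w)) = qnorm T (u1 - u0) + 2 * ((u0 - w) \<bullet> T (u1 - u0)) + qnorm T (u0 - w)"
    by (rule qnorm_add[OF assms])
  moreover have "(u1 - w) \<bullet> T (u1 - u0) = qnorm T (u1 - u0) + (u0 - w) \<bullet> T (u1 - u0)"
    by (simp add: qnorm_def inner_diff_left)
  ultimately show ?thesis by simp
qed

lemma psd_op_add: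
  assumes "psd_op S" "psd_op T"
  shows "psd_op (\<lambda>w. S w + T w)"
  unfolding psd_op_def
proof (intro conjI allI self_adjointI)
  show "linear (\<lambda>w. S w + T w)" by (intro linear_compose_add psd_opD(1) assms)
  show "(S x + T x) \<bullet> y = x \<bullet> (S y + T y)" for x y
    by (simp add: psd_opD(2)[OF assms(1)] psd_opD(2)[OF assms(2)] inner_add_left inner_add_right)
  show "0 \<le> w \<bullet> (S w + T w)" for w
    using psd_opD(3)[OF assms(1), of w] psd_opD(3)[OF assms(2), of w]
    by (simp add: qnorm_def inner_add_right)
qed

lemma psd_op_congruence:
  fixes L :: "'a::euclidean_space \<Rightarrow> 'b::euclidean_space"
  assumes L: "linear L" and S: "psd_op S"
  shows "psd_op (\<lambda>w. L (S (adjoint L w)))"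
  unfolding psd_op_def
proof (intro conjI allI self_adjointI)
  have L': "linear (adjoint L)" by (rule adjoint_linear[OF L])
  have S': "linear S" by (rule psd_opD(1)[OF S])
  show "linear (\<lambda>w. L (S (adjoint L w)))"
    using linear_compose[OF linear_compose[OF L' S'] L] by (simp add: o_def)
  show "L (S (adjoint L x)) \<bullet> y = x \<bullet> L (S (adjoint L y))" for x y
    using adjoint_works[OF L, of "S (adjoint L x)" y] adjoint_works[OF L, of "S (adjoint L y)" x]
      psd_opD(2)[OF S, of "adjoint L x" "adjoint L y"] by (simp add: inner_commute)
  show "0 \<le> w \<bullet> L (S (adjoint L w))" for w
    using psd_opD(3)[OF S, of "adjoint L w"] adjoint_works[OF L, of "S (adjoint L w)" w]
    by (simp add: qnorm_def inner_commute)
qed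

lemma pd_op_bij:
  assumes "pd_op E"
  shows "bij E"
proof -
  have E: "linear E" using assms self_adjointD(1) by (auto simp: pd_op_def)
  have "w = 0" if "E w = 0" for w
    using assms that by (metis inner_zero_right less_irrefl pd_op_def)
  then have "inj E" using linear_injective_0[OF E] by blast
  then show ?thesis using linear_injective_imp_surjective[OF E] by (simp add: bij_def)
qed

lemma pd_op_imp_psd_op:
  assumes "pd_op E"
  shows "psd_op E"
proof -
  have "0 \<le> w \<bullet> E w" for w using assms by (cases "w = 0") (auto simp: pd_op_def less_imp_le)
  then show ?thesis using assms by (simp add: psd_op_def pd_op_def)
qed

lemma psd_op_inv:
  assumes E: "pd_op E"
  shows "psd_op (inv E)"
  unfolding psd_op_def
proof (intro conjI allI self_adjointI)
  have lin: "linear E" and sym: "\<And>x y. E x \<bullet> y = x \<bullet> E y" and nn: "\<And>x. 0 \<le> qnorm E x"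
    using psd_opD[OF pd_op_imp_psd_op[OF E]] by auto
  have inj: "inj E" and surj: "surj E" using pd_op_bij[OF E] by (auto simp: bij_def)
  have inv: "E (inv E y) = y" for y by (rule surj_f_inv_f[OF surj])
  show "linear (inv E)"
  proof (rule linearI)
    show "inv E (x + y) = inv E x + inv E y" for x y
      by (rule injD[OF inj]) (simp add: inv linear_add[OF lin])
    show "inv E (t *\<^sub>R x) = t *\<^sub>R inv E x" for t x
      by (rule injD[OF inj]) (simp add: inv linear_scale[OF lin])
  qed
  show "inv E x \<bullet> y = x \<bullet> inv E y" for x y using sym[of "inv E x" "inv E y"] by (simp add: inv)
  show "0 \<le> w \<bullet> inv E w" for w
    using nn[of "inv E w"] by (simp add: qnorm_def inv inner_commute)
qed

text \<open>Subtracting the accumulated errors from \<open>E\<close> gives a decreasing sequence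
  that stays above \<open>- suminf e\<close>. Its total decrease is finite and dominates the partial
  sums of \<open>d\<close>.\<close>

lemma quasi_fejer:
  fixes E d e :: "nat \<Rightarrow> real"
  assumes step: "\<And>k. E (Suc k) + d k \<le> E k + e k"
    and nn: "\<And>k. 0 \<le> E k" "\<And>k. 0 \<le> d k" "\<And>k. 0 \<le> e k" and e: "summable e"
  shows "summable d" "convergent E"
proof -
  define S where "S k = E k - sum e {..<k}" for k
  have S: "S (Suc k) \<le> S k - d k" for k using step[of k] by (simp add: S_def)
  have low: "- suminf e \<le> S k" for k
    using nn(1)[of k] sum_le_suminf[OF e, of "{..<k}"] nn(3) by (simp add: S_def)
  have dec: "decseq S" using order_trans[OF S] nn(2) by (intro decseq_SucI) simp
  then have cS: "convergent S"
    using low decseq_convergent[of S "- suminf e"] by (metis convergent_def)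
  have "convergent (\<lambda>k. sum e {..<k})" using e by (simp add: summable_iff_convergent)
  from convergent_add[OF cS this] show "convergent E" by (simp add: S_def)
  have tel: "sum d {..<n} \<le> S 0 - S n" for n
  proof (induction n)
    case (Suc n)
    then show ?case using S[of n] by simp
  qed simp
  have "sum d {..<n} \<le> S 0 + suminf e" for n using low[of n] tel[of n] by simp
  then show "summable d" using nn(2) by (intro summableI_nonneg_bounded) auto
qed

section \<open>Proximal augmented Lagrangian steps\<close>

text \<open>The proximal operators are arbitrary semidefinite ones here; the special shape of
  \<open>Thf\<close> and \<open>Tg\<close> enters only in the final theorem. Monotonicity is stated
  without domain conditions because a subgradient exists only at points of the domain.\<close>

locale prox_alm =
  fixes f :: "'u::euclidean_space \<Rightarrow> ereal"
    and Sg :: "'v::euclidean_space \<Rightarrow> 'v" and b :: "'v"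
    and F :: "'x::euclidean_space \<Rightarrow> 'u" and G :: "'x \<Rightarrow> 'v" and c :: "'x"
    and Sf :: "'u \<Rightarrow> 'u" and Tu :: "'u \<Rightarrow> 'u" and Tv :: "'v \<Rightarrow> 'v" and \<sigma> :: real
  assumes cpc: "closed_proper_convex f"
    and Sg: "psd_op Sg" and F: "linear F" and G: "linear G" and Sf: "psd_op Sf"
    and mono: "\<And>u1 u2 \<xi>1 \<xi>2. \<xi>1 \<in> subdiff f u1 \<Longrightarrow> \<xi>2 \<in> subdiff f u2 \<Longrightarrow>
                 qnorm Sf (u1 - u2) \<le> (\<xi>1 - \<xi>2) \<bullet> (u1 - u2)"
    and sigma: "\<sigma> > 0" and Tu: "psd_op Tu" and Tv: "psd_op Tv"
begin

definition res :: "'u \<Rightarrow> 'v \<Rightarrow> 'x" where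
  "res u v = adjoint F u + adjoint G v - c"

definition kkt :: "'u \<Rightarrow> 'v \<Rightarrow> 'x \<Rightarrow> bool" where
  "kkt u v x \<longleftrightarrow> - F x \<in> subdiff f u \<and> Sg v - b + G x = 0 \<and> res u v = 0"

definition smooth_part :: "'u \<Rightarrow> 'v \<Rightarrow> 'x \<Rightarrow> 'u \<Rightarrow> 'v \<Rightarrow> real" where
  "smooth_part uk vk xk u v = quad_fun Sg b v + xk \<bullet> res u v + \<sigma> / 2 * (norm (res u v))\<^sup>2
     + (\<sigma> / 2 * qnorm Tu (u - uk) + \<sigma> / 2 * qnorm Tv (v - vk))"

definition grad_u :: "'u \<Rightarrow> 'x \<Rightarrow> 'u \<Rightarrow> 'v \<Rightarrow> 'u" where
  "grad_u uk xk u v = F (xk + \<sigma> *\<^sub>R res u v) + \<sigma> *\<^sub>R Tu (u - uk)"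

definition grad_v :: "'v \<Rightarrow> 'x \<Rightarrow> 'u \<Rightarrow> 'v \<Rightarrow> 'v" where
  "grad_v vk xk u v = Sg v - b + G (xk + \<sigma> *\<^sub>R res u v) + \<sigma> *\<^sub>R Tv (v - vk)"

text \<open>The second derivative of \<open>smooth_part\<close> is \<sigma> times this form; the
  normalization makes the proximal operators appear with weight 1.\<close>

definition hess :: "'u \<Rightarrow> 'v \<Rightarrow> real" where
  "hess s z = (norm (adjoint F s + adjoint G z))\<^sup>2 + qnorm Tu s + qnorm Tv z + qnorm Sg z / \<sigma>"

text \<open>Adds to \<open>hess\<close> the curvature that \<open>f\<close> is guaranteed to have,
  on the same scale.\<close>

definition curv :: "'u \<Rightarrow> 'v \<Rightarrow> real" where
  "curv s z = qnorm Sf s / \<sigma> + hess s z"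

lemma f_props:
  "proper_fun f" "convex (eepigraph f)" "closed (eepigraph f)"
  using cpc by (auto simp: closed_proper_convex_def)

lemma lin_adj: "linear (adjoint F)" "linear (adjoint G)"
  using adjoint_linear F G by auto

lemma inner_adj: "(adjoint F s + adjoint G z) \<bullet> y = s \<bullet> F y + z \<bullet> G y"
  using adjoint_works[OF F, of y s] adjoint_works[OF G, of y z]
  by (simp add: inner_add_right inner_commute)

lemma res_add: "res (u + s) (v + z) = res u v + (adjoint F s + adjoint G z)"
  using lin_adj by (simp add: res_def linear_add)

lemma spalm_sub_eq:
  "spalm_sub f (quad_fun Sg b) F G c \<sigma> Tu Tv uk vk xk u v = f u + ereal (smooth_part uk vk xk u v)"
  by (simp add: spalm_sub_def aug_lag_def smooth_part_def res_def add.assoc)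

text \<open>An exact Taylor expansion, since the smooth part is quadratic. Optimality, uniqueness
  and coercivity of the subproblem are all read off from it.\<close>

lemma smooth_part_add:
  "smooth_part uk vk xk (u + s) (v + z) = smooth_part uk vk xk u v
     + s \<bullet> grad_u uk xk u v + z \<bullet> grad_v vk xk u v + \<sigma> / 2 * hess s z"
proof -
  define r where "r = res u v"
  define d where "d = adjoint F s + adjoint G z"
  have u: "qnorm Tu (u + s - uk) = qnorm Tu (u - uk) + 2 * (s \<bullet> Tu (u - uk)) + qnorm Tu s"
    using qnorm_add[OF Tu, of "u - uk" s] by (simp add: algebra_simps)
  have v: "qnorm Tv (v + z - vk) = qnorm Tv (v - vk) + 2 * (z \<bullet> Tv (v - vk)) + qnorm Tv z"
    using qnorm_add[OF Tv, of "v - vk" z] by (simp add: algebra_simps)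
  have n: "(norm (r + d))\<^sup>2 = (norm r)\<^sup>2 + 2 * (d \<bullet> r) + (norm d)\<^sup>2"
    by (simp add: power2_norm_eq_inner inner_add_left inner_add_right inner_commute)
  \<comment> \<open>The multiplier term and the derivative of the penalty combine into one pairing
    with the shifted multiplier \<open>xk + \<sigma> *\<^sub>R r\<close>, which the adjoints then
    distribute over \<open>s\<close> and \<open>z\<close>.\<close>
  have d: "d \<bullet> (xk + \<sigma> *\<^sub>R r) = s \<bullet> F (xk + \<sigma> *\<^sub>R r) + z \<bullet> G (xk + \<sigma> *\<^sub>R r)"
    unfolding d_def by (rule inner_adj)
  have d': "d \<bullet> (xk + \<sigma> *\<^sub>R r) = xk \<bullet> d + \<sigma> * (d \<bullet> r)"
    by (simp add: inner_add_right inner_commute)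
  have "smooth_part uk vk xk (u + s) (v + z) = smooth_part uk vk xk u v + z \<bullet> (Sg v - b)
     + (xk \<bullet> d + \<sigma> * (d \<bullet> r)) + \<sigma> * (s \<bullet> Tu (u - uk)) + \<sigma> * (z \<bullet> Tv (v - vk))
     + (qnorm Sg z / 2 + \<sigma> / 2 * (norm d)\<^sup>2 + \<sigma> / 2 * qnorm Tu s + \<sigma> / 2 * qnorm Tv z)"
    unfolding smooth_part_def res_add quad_fun_add[OF Sg] u v
    unfolding d_def[symmetric] r_def[symmetric] n
    by (simp add: algebra_simps)
  also have "(qnorm Sg z / 2 + \<sigma> / 2 * (norm d)\<^sup>2 + \<sigma> / 2 * qnorm Tu s + \<sigma> / 2 * qnorm Tv z)
      = \<sigma> / 2 * hess s z"
    using sigma by (simp add: hess_def d_def field_simps)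
  finally show ?thesis
    unfolding d'[symmetric] d grad_u_def grad_v_def r_def[symmetric]
    by (simp add: inner_add_right)
qed

lemma hess_scaleR: "hess (t *\<^sub>R s) (t *\<^sub>R z) = t\<^sup>2 * hess s z"
proof -
  have "adjoint F (t *\<^sub>R s) + adjoint G (t *\<^sub>R z) = t *\<^sub>R (adjoint F s + adjoint G z)"
    using lin_adj by (simp add: linear_scale scaleR_add_right)
  then have "(norm (adjoint F (t *\<^sub>R s) + adjoint G (t *\<^sub>R z)))\<^sup>2
      = t\<^sup>2 * (norm (adjoint F s + adjoint G z))\<^sup>2"
    by (simp only: norm_scaleR power_mult_distrib power2_abs)
  then show ?thesis
    by (simp add: hess_def qnorm_scaleR psd_opD(1)[OF Tu] psd_opD(1)[OF Tv] psd_opD(1)[OF Sg]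
        algebra_simps)
qed

lemma hess_nonneg: "0 \<le> hess s z"
  using psd_opD(3)[OF Tu] psd_opD(3)[OF Tv] psd_opD(3)[OF Sg] sigma by (simp add: hess_def)

lemma curv_scaleR: "curv (t *\<^sub>R s) (t *\<^sub>R z) = t\<^sup>2 * curv s z"
  by (simp add: curv_def hess_scaleR qnorm_scaleR psd_opD(1)[OF Sf] algebra_simps)

text \<open>Expand from the second point to the first and back, and add: the function values
  cancel.\<close>

lemma grad_monotone:
  "(u1 - u2) \<bullet> (grad_u uk xk u1 v1 - grad_u uk xk u2 v2)
     + (v1 - v2) \<bullet> (grad_v vk xk u1 v1 - grad_v vk xk u2 v2) = \<sigma> * hess (u1 - u2) (v1 - v2)"
proof -
  have "hess (u2 - u1) (v2 - v1) = hess (u1 - u2) (v1 - v2)"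
    using hess_scaleR[of "-1" "u1 - u2" "v1 - v2"] by simp
  with smooth_part_add[of uk vk xk u2 "u1 - u2" v2 "v1 - v2"]
    smooth_part_add[of uk vk xk u1 "u2 - u1" v1 "v2 - v1"]
  show ?thesis by (simp add: inner_diff_left inner_diff_right algebra_simps)
qed

lemma argmin_optimality:
  assumes "spalm_argmin f (quad_fun Sg b) F G c \<sigma> Tu Tv uk vk xk u v"
  shows "- grad_u uk xk u v \<in> subdiff f u" "grad_v vk xk u v = 0"
proof -
  let ?h = "smooth_part uk vk xk"
  have min: "f u + ereal (?h u v) \<le> f u' + ereal (?h u' v')" for u' v'
    using assms by (simp add: spalm_argmin_def spalm_sub_eq)
  obtain u' where "f u' \<noteq> \<infinity>" using f_props by (auto simp: proper_fun_def)
  with min[of u' v] have "f u \<noteq> \<infinity>" by auto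
  then have u: "u \<in> edom f" by (simp add: edom_def)
  show "- grad_u uk xk u v \<in> subdiff f u"
  proof (rule minimizer_subdiff[OF f_props(1,2) u, where C = "\<lambda>z. \<sigma> / 2 * hess z 0"])
    show "f u + ereal (?h u v) \<le> f y + ereal (?h y v)" for y by (rule min)
    show "?h (u + t *\<^sub>R z) v = ?h u v + t * (grad_u uk xk u v \<bullet> z) + t\<^sup>2 * (\<sigma> / 2 * hess z 0)" for z t
      using smooth_part_add[of uk vk xk u "t *\<^sub>R z" v 0] hess_scaleR[of t z 0]
      by (simp add: inner_commute)
  qed
  obtain a where a: "f u = ereal a" using proper_edomE[OF f_props(1) u] .
  \<comment> \<open>Move along the negative gradient: the first-order change is minus its squared
    norm, which minimality does not allow to be negative.\<close>
  have "0 \<le> - (norm (grad_v vk xk u v))\<^sup>2"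
  proof (rule linear_le_quadratic_imp_nonneg)
    fix t :: real
    let ?d = "grad_v vk xk u v"
    have "?h u v \<le> ?h (u + 0) (v + (- t) *\<^sub>R ?d)" using min[of u "v + (- t) *\<^sub>R ?d"] a by simp
    then show "0 \<le> t * (- (norm ?d)\<^sup>2) + t\<^sup>2 * (\<sigma> / 2 * hess 0 ?d)"
      unfolding smooth_part_add using hess_scaleR[of "- t" 0 ?d]
      by (simp add: power2_norm_eq_inner mult.left_commute)
  qed
  then show "grad_v vk xk u v = 0" by simp
qed

section \<open>KKT triples: optimality for both problems, and existence\<close>

lemma kkt_solves_P:
  assumes "kkt u v x"
  shows "solves_P f (quad_fun Sg b) F G c u v"
proof -
  have feas: "P_feasible F G c u v" using assms by (simp add: kkt_def res_def P_feasible_def)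
  have "f u + ereal (quad_fun Sg b v) \<le> f u' + ereal (quad_fun Sg b v')"
    if "P_feasible F G c u' v'" for u' v'
  proof -
    have "adjoint F (u' - u) + adjoint G (v' - v) = 0"
      using that feas lin_adj by (simp add: P_feasible_def linear_diff algebra_simps)
    \<comment> \<open>Along feasible directions the linear terms in the subgradient inequalities for
      \<open>f\<close> and for the quadratic cancel.\<close>
    then have 0: "(u' - u) \<bullet> F x + (v' - v) \<bullet> G x = 0" by (metis inner_adj inner_zero_left)
    have "Sg v - b = - G x" using assms by (simp add: kkt_def eq_neg_iff_add_eq_0)
    then have "quad_fun Sg b v - (v' - v) \<bullet> G x \<le> quad_fun Sg b v'"
      using quad_fun_add[OF Sg, of b v "v' - v"] psd_opD(3)[OF Sg, of "v' - v"] by simp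
    then have g: "ereal (quad_fun Sg b v + (u' - u) \<bullet> F x) \<le> ereal (quad_fun Sg b v')"
      using 0 by simp
    have "f u + ereal (- F x \<bullet> (u' - u)) \<le> f u'" using assms by (auto simp: kkt_def subdiff_def)
    from add_mono[OF this g] show ?thesis
      by (cases "f u"; cases "f u'") (auto simp: inner_commute)
  qed
  with feas show ?thesis by (simp add: solves_P_def)
qed

text \<open>The Fenchel-Young inequalities at the fixed pair \<open>(u, v)\<close> bound every
  feasible dual value below by minus the primal value; at a KKT triple both hold with equality, so
  \<open>x\<close> attains the bound.\<close>

lemma kkt_solves_D:
  assumes "kkt u v x"
  shows "solves_D f (quad_fun Sg b) F G c x"
proof -
  let ?g = "quad_fun Sg b"
  have sub: "- F x \<in> subdiff f u" using assms by (simp add: kkt_def)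
  obtain a where a: "f u = ereal a" using proper_edomE[OF f_props(1) subdiff_edom[OF f_props(1) sub]] .
  have feas: "adjoint F u + adjoint G v = c" using assms by (simp add: kkt_def res_def)
  have c: "c \<bullet> y = u \<bullet> F y + v \<bullet> G y" for y using inner_adj[of u v y] feas by simp
  have weak: "ereal (- a - ?g v) \<le> D_obj f ?g c y (- F y) (- G y)" for y
  proof -
    have "ereal (- F y \<bullet> u) - f u \<le> fconj f (- F y)" unfolding fconj_def by (rule SUP_upper) simp
    then have 1: "ereal (- F y \<bullet> u - a) \<le> fconj f (- F y)" using a by simp
    have "ereal (- G y \<bullet> v) - ereal (?g v) \<le> fconj (\<lambda>v. ereal (?g v)) (- G y)"
      unfolding fconj_def by (rule SUP_upper) simp
    then have 2: "ereal (- G y \<bullet> v - ?g v) \<le> fconj (\<lambda>v. ereal (?g v)) (- G y)" by simp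
    have "ereal (c \<bullet> y) + ereal (- F y \<bullet> u - a) + ereal (- G y \<bullet> v - ?g v)
        \<le> D_obj f ?g c y (- F y) (- G y)"
      unfolding D_obj_def by (intro add_mono 1 2 order_refl)
    then show ?thesis by (simp add: c inner_commute)
  qed
  have "fconj f (- F x) \<le> ereal (- F x \<bullet> u - a)"
    unfolding fconj_def
  proof (rule SUP_least)
    fix y
    have "f u + ereal (- F x \<bullet> (y - u)) \<le> f y" using sub by (auto simp: subdiff_def)
    then show "ereal (- F x \<bullet> y) - f y \<le> ereal (- F x \<bullet> u - a)"
      using a by (cases "f y") (auto simp: inner_diff_right)
  qed
  moreover have "fconj (\<lambda>v. ereal (?g v)) (- G x) \<le> ereal (- G x \<bullet> v - ?g v)"
    unfolding fconj_def
  proof (rule SUP_least)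
    fix y
    have "Sg v - b = - G x" using assms by (simp add: kkt_def eq_neg_iff_add_eq_0)
    then have "?g v - (y - v) \<bullet> G x \<le> ?g y"
      using quad_fun_add[OF Sg, of b v "y - v"] psd_opD(3)[OF Sg, of "y - v"] by simp
    then show "ereal (- G x \<bullet> y) - ereal (?g y) \<le> ereal (- G x \<bullet> v - ?g v)"
      by (simp add: inner_diff_right inner_commute)
  qed
  ultimately have "D_obj f ?g c x (- F x) (- G x)
      \<le> ereal (c \<bullet> x) + ereal (- F x \<bullet> u - a) + ereal (- G x \<bullet> v - ?g v)"
    unfolding D_obj_def by (intro add_mono order_refl)
  also have "\<dots> = ereal (- a - ?g v)" by (simp add: c inner_commute)
  finally have strong: "D_obj f ?g c x (- F x) (- G x) \<le> ereal (- a - ?g v)" .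
  have "D_obj f ?g c x (- F x) (- G x) \<le> D_obj f ?g c y s t" if "D_feasible F G y s t" for y s t
  proof -
    have "s = - F y" "t = - G y"
      using that by (auto simp: D_feasible_def add_eq_0_iff)
    then show ?thesis using order_trans[OF strong weak[of y]] by simp
  qed
  then show ?thesis by (simp add: solves_D_def solves_D_triple_def D_feasible_def)
qed

text \<open>With the multiplier of the joint problem, \<open>(u, v)\<close> minimizes the Lagrangian
  without constraints, and varying one block at a time gives the two stationarity conditions. The
  quadratic is finite everywhere, so the Slater condition concerns \<open>u\<close> only.\<close>

lemma kkt_exists:
  assumes sol: "solves_P f (quad_fun Sg b) F G c u v"
    and uh: "uh \<in> rel_interior (edom f)" "P_feasible F G c uh vh"
  shows "\<exists>x. kkt u v x"
proof -
  let ?g = "quad_fun Sg b"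
  define \<phi> where "\<phi> w = f (fst w) + ereal (?g (snd w))" for w :: "'u \<times> 'v"
  define A where "A w = adjoint F (fst w) + adjoint G (snd w)" for w :: "'u \<times> 'v"
  have A: "linear A" using lin_adj
    by (intro linearI) (auto simp: A_def linear_add linear_scale scaleR_add_right)
  have edom: "edom \<phi> = edom f \<times> UNIV" by (auto simp: edom_def \<phi>_def)
  have proper: "proper_fun \<phi>" using f_props(1) by (auto simp: proper_fun_def \<phi>_def)
  have epi: "(w, r) \<in> eepigraph \<phi> \<longleftrightarrow> (fst w, r - ?g (snd w)) \<in> eepigraph f" for w r
    by (cases "f (fst w)") (auto simp: eepigraph_def \<phi>_def)
  have cvx: "convex (eepigraph \<phi>)"
  proof (rule convexI)
    fix p q and s t :: real
    assume p: "p \<in> eepigraph \<phi>" and q: "q \<in> eepigraph \<phi>" and st: "0 \<le> s" "0 \<le> t" "s + t = 1"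
    obtain u1 v1 r1 where p': "p = ((u1, v1), r1)" by (metis prod.exhaust)
    obtain u2 v2 r2 where q': "q = ((u2, v2), r2)" by (metis prod.exhaust)
    have "s *\<^sub>R (u1, r1 - ?g v1) + t *\<^sub>R (u2, r2 - ?g v2) \<in> eepigraph f"
      using p q p' q' st epi by (intro convexD[OF f_props(2)]) auto
    then have "f (s *\<^sub>R u1 + t *\<^sub>R u2) \<le> ereal (s * (r1 - ?g v1) + t * (r2 - ?g v2))"
      by (simp add: eepigraph_def)
    also have "\<dots> \<le> ereal (s * r1 + t * r2 - ?g (s *\<^sub>R v1 + t *\<^sub>R v2))"
    proof -
      let ?m = "s *\<^sub>R v1 + t *\<^sub>R v2"
      \<comment> \<open>Convexity of the quadratic through its tangent at the convex combination:
        the two linear terms average to zero.\<close>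
      have le: "?g ?m + (y - ?m) \<bullet> (Sg ?m - b) \<le> ?g y" for y
        using quad_fun_add[OF Sg, of b ?m "y - ?m"] psd_opD(3)[OF Sg, of "y - ?m"] by simp
      have "s *\<^sub>R (v1 - ?m) + t *\<^sub>R (v2 - ?m) = ?m - (s + t) *\<^sub>R ?m"
        by (simp only: scaleR_diff_right scaleR_add_left) (simp add: algebra_simps)
      then have 0: "s *\<^sub>R (v1 - ?m) + t *\<^sub>R (v2 - ?m) = 0" using st by simp
      have "s * ((v1 - ?m) \<bullet> (Sg ?m - b)) + t * ((v2 - ?m) \<bullet> (Sg ?m - b))
          = (s *\<^sub>R (v1 - ?m) + t *\<^sub>R (v2 - ?m)) \<bullet> (Sg ?m - b)"
        by (simp only: inner_add_left inner_scaleR_left)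
      also have "\<dots> = 0" unfolding 0 by simp
      finally have z: "s * ((v1 - ?m) \<bullet> (Sg ?m - b)) + t * ((v2 - ?m) \<bullet> (Sg ?m - b)) = 0" .
      have "s * (?g ?m + (v1 - ?m) \<bullet> (Sg ?m - b)) + t * (?g ?m + (v2 - ?m) \<bullet> (Sg ?m - b))
          \<le> s * ?g v1 + t * ?g v2"
        by (intro add_mono mult_left_mono le st)
      moreover have "s * (?g ?m + (v1 - ?m) \<bullet> (Sg ?m - b)) + t * (?g ?m + (v2 - ?m) \<bullet> (Sg ?m - b))
          = (s + t) * ?g ?m"
        using z by (simp only: distrib_left distrib_right)
      ultimately have "?g ?m \<le> s * ?g v1 + t * ?g v2" using st by simp
      then show ?thesis by (simp add: right_diff_distrib)
    qed
    finally have "(s *\<^sub>R u1 + t *\<^sub>R u2, s * r1 + t * r2 - ?g (s *\<^sub>R v1 + t *\<^sub>R v2)) \<in> eepigraph f"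
      by (simp add: eepigraph_def)
    then show "s *\<^sub>R p + t *\<^sub>R q \<in> eepigraph \<phi>" using epi p' q' by simp
  qed
  have ri: "(uh, vh) \<in> rel_interior (edom \<phi>)"
    using uh rel_interior_Times[OF convex_edom[OF f_props(1,2)] convex_UNIV[where 'a='v]] by (simp add: edom)
  have min: "\<phi> (u, v) \<le> \<phi> w" if "A w = c" for w
    using sol that by (simp add: solves_P_def P_feasible_def \<phi>_def A_def)
  have Auv: "A (u, v) = c" using sol by (simp add: solves_P_def P_feasible_def A_def)
  obtain x where x: "\<And>w. \<phi> (u, v) \<le> \<phi> w + ereal (x \<bullet> (A w - c))"
    using lagrange_multiplier[OF proper cvx A ri _ Auv min] uh by (auto simp: A_def P_feasible_def)
  have "\<phi> (u, v) \<le> \<phi> (uh, vh)" using min uh by (auto simp: A_def P_feasible_def)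
  moreover have "(uh, vh) \<in> edom \<phi>" using ri rel_interior_subset by blast
  ultimately have u: "u \<in> edom f" by (auto simp: edom_def \<phi>_def)
  obtain a where a: "f u = ereal a" using proper_edomE[OF f_props(1) u] .
  have F_sub: "- F x \<in> subdiff f u"
  proof (rule minimizer_subdiff[OF f_props(1,2) u, where C = "\<lambda>_. 0"])
    fix y
    have "\<phi> (u, v) \<le> \<phi> (y, v) + ereal (x \<bullet> (A (y, v) - c))" by (rule x)
    moreover have "x \<bullet> (A (y, v) - c) = F x \<bullet> y - F x \<bullet> u"
      using inner_adj[of y 0 x] inner_adj[of u 0 x] Auv linear_0[OF lin_adj(2)]
      by (simp add: A_def inner_diff_right inner_add_right inner_commute algebra_simps flip: Auv)
    ultimately show "f u + ereal (F x \<bullet> u) \<le> f y + ereal (F x \<bullet> y)"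
      using a by (cases "f y") (auto simp: \<phi>_def)
  next
    show "F x \<bullet> (u + t *\<^sub>R z) = F x \<bullet> u + t * (F x \<bullet> z) + t\<^sup>2 * 0" for z t
      by (simp add: inner_add_right)
  qed
  define d where "d = Sg v - b + G x"
  have "0 \<le> - (norm d)\<^sup>2"
  proof (rule linear_le_quadratic_imp_nonneg)
    fix t :: real
    have "\<phi> (u, v) \<le> \<phi> (u, v + (- t) *\<^sub>R d) + ereal (x \<bullet> (A (u, v + (- t) *\<^sub>R d) - c))" by (rule x)
    moreover have "x \<bullet> (A (u, v + (- t) *\<^sub>R d) - c) = - t * (d \<bullet> G x)"
      using inner_adj[of 0 d x] linear_0[OF lin_adj(1)]
      by (simp add: A_def linear_add[OF lin_adj(2)] linear_scale[OF lin_adj(2)] linear_diff[OF lin_adj(2)]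
          inner_diff_right inner_add_right inner_commute flip: Auv)
    ultimately have "?g v \<le> ?g (v + (- t) *\<^sub>R d) - t * (d \<bullet> G x)"
      using a by (simp add: \<phi>_def)
    moreover have "?g (v + (- t) *\<^sub>R d) = ?g v - t * (d \<bullet> (Sg v - b)) + t\<^sup>2 * (qnorm Sg d / 2)"
      using quad_fun_add[OF Sg, of b v "(- t) *\<^sub>R d"] qnorm_scaleR[OF psd_opD(1)[OF Sg], of "- t" d] by simp
    moreover have "t * (d \<bullet> (Sg v - b)) + t * (d \<bullet> G x) = t * (norm d)\<^sup>2"
      by (simp add: d_def power2_norm_eq_inner inner_add_right flip: distrib_left)
    ultimately show "0 \<le> t * (- (norm d)\<^sup>2) + t\<^sup>2 * (qnorm Sg d / 2)"
      by simp
  qed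
  then have "d = 0" by simp
  then show ?thesis using F_sub Auv by (auto simp: kkt_def d_def res_def A_def)
qed

section \<open>Energy and its descent along one step\<close>

text \<open>The weight \<open>1 / (\<tau> * \<sigma>)\<close> makes the cross term of the multiplier
  update cancel the one coming from the optimality conditions.\<close>

definition energy :: "real \<Rightarrow> 'u \<Rightarrow> 'v \<Rightarrow> 'x \<Rightarrow> 'u \<Rightarrow> 'v \<Rightarrow> 'x \<Rightarrow> real" where
  "energy \<tau> ub vb xb u v x =
     (norm (x - xb))\<^sup>2 / (\<tau> * \<sigma>) + \<sigma> * (qnorm Tu (u - ub) + qnorm Tv (v - vb))"

text \<open>Subtract the KKT conditions from the optimality conditions of the step and pair with the
  error \<open>(s, z)\<close>. The adjoints turn the multiplier terms into a pairing with the
  residual, and the three-point identity handles the proximal terms.\<close>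

lemma energy_descent:
  assumes tau: "\<tau> > 0" and kkt: "kkt ub vb xb"
    and am: "spalm_argmin f (quad_fun Sg b) F G c \<sigma> Tu Tv uk vk xk u v"
  shows "energy \<tau> ub vb xb u v (xk + (\<tau> * \<sigma>) *\<^sub>R res u v)
      + ((2 - \<tau>) * \<sigma> * (norm (res u v))\<^sup>2 + \<sigma> * (qnorm Tu (u - uk) + qnorm Tv (v - vk))
         + 2 * (qnorm Sf (u - ub) + qnorm Sg (v - vb))) \<le> energy \<tau> ub vb xb uk vk xk"
proof -
  define s where "s = u - ub"
  define z where "z = v - vb"
  define r where "r = res u v"
  \<comment> \<open>The multiplier for which the step satisfies the KKT stationarity conditions up
    to proximal terms; it is the new iterate only when \<tau> is 1.\<close>
  define y where "y = xk + \<sigma> *\<^sub>R r"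
  have r: "r = adjoint F s + adjoint G z"
    using kkt res_add[of ub s vb z] by (simp add: kkt_def r_def s_def z_def)
  have "qnorm Sf s \<le> (- grad_u uk xk u v - - F xb) \<bullet> (u - ub)"
    unfolding s_def using kkt argmin_optimality[OF am] by (intro mono) (auto simp: kkt_def)
  also have "\<dots> = - (s \<bullet> F (y - xb)) - \<sigma> * (s \<bullet> Tu (u - uk))"
    by (simp add: grad_u_def linear_diff[OF F] inner_diff_right inner_diff_left inner_add_left
        inner_commute algebra_simps flip: s_def r_def y_def)
  finally have 1: "qnorm Sf s \<le> - (s \<bullet> F (y - xb)) - \<sigma> * (s \<bullet> Tu (u - uk))" .
  have "grad_v vk xk u v - (Sg vb - b + G xb) = 0"
    using kkt argmin_optimality(2)[OF am] by (simp add: kkt_def)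
  then have "Sg z + G (y - xb) + \<sigma> *\<^sub>R Tv (v - vk) = 0"
    by (simp add: grad_v_def z_def linear_diff[OF psd_opD(1)[OF Sg]] linear_diff[OF G] algebra_simps
        flip: r_def y_def)
  then have "z \<bullet> (Sg z + G (y - xb) + \<sigma> *\<^sub>R Tv (v - vk)) = 0" by simp
  then have 2: "qnorm Sg z + z \<bullet> G (y - xb) + \<sigma> * (z \<bullet> Tv (v - vk)) = 0"
    by (simp add: inner_add_right qnorm_def)
  have 3: "s \<bullet> F (y - xb) + z \<bullet> G (y - xb) = r \<bullet> (xk - xb) + \<sigma> * (norm r)\<^sup>2"
    unfolding inner_adj[symmetric] r[symmetric]
    by (simp add: y_def inner_add_right inner_diff_right power2_norm_eq_inner)
  have 4: "2 * (s \<bullet> Tu (u - uk)) = qnorm Tu s + qnorm Tu (u - uk) - qnorm Tu (uk - ub)"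
    unfolding s_def by (rule qnorm_three_point[OF Tu])
  have 5: "2 * (z \<bullet> Tv (v - vk)) = qnorm Tv z + qnorm Tv (v - vk) - qnorm Tv (vk - vb)"
    unfolding z_def by (rule qnorm_three_point[OF Tv])
  have "xk + (\<tau> * \<sigma>) *\<^sub>R r - xb = (xk - xb) + (\<tau> * \<sigma>) *\<^sub>R r" by simp
  then have "(norm (xk + (\<tau> * \<sigma>) *\<^sub>R r - xb))\<^sup>2 = (norm ((xk - xb) + (\<tau> * \<sigma>) *\<^sub>R r))\<^sup>2"
    by (rule arg_cong)
  also have "\<dots> = (norm (xk - xb))\<^sup>2 + 2 * (\<tau> * \<sigma>) * (r \<bullet> (xk - xb)) + (\<tau> * \<sigma>)\<^sup>2 * (norm r)\<^sup>2"
    unfolding power2_norm_eq_inner inner_add_left inner_add_right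
    by (simp add: inner_commute[of r "xk - xb"] power2_eq_square)
  finally have 6: "(norm (xk + (\<tau> * \<sigma>) *\<^sub>R r - xb))\<^sup>2 / (\<tau> * \<sigma>)
      = (norm (xk - xb))\<^sup>2 / (\<tau> * \<sigma>) + 2 * (r \<bullet> (xk - xb)) + \<tau> * \<sigma> * (norm r)\<^sup>2"
    using tau sigma by (simp add: field_simps power2_eq_square)
  have 7: "2 * (\<sigma> * (s \<bullet> Tu (u - uk))) = \<sigma> * (qnorm Tu s + qnorm Tu (u - uk) - qnorm Tu (uk - ub))"
    unfolding 4[symmetric] by simp
  have 8: "2 * (\<sigma> * (z \<bullet> Tv (v - vk))) = \<sigma> * (qnorm Tv z + qnorm Tv (v - vk) - qnorm Tv (vk - vb))"
    unfolding 5[symmetric] by simp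
  have "2 * (qnorm Sf s + qnorm Sg z) + 2 * (r \<bullet> (xk - xb)) + 2 * (\<sigma> * (norm r)\<^sup>2)
      + \<sigma> * (qnorm Tu s + qnorm Tu (u - uk) - qnorm Tu (uk - ub))
      + \<sigma> * (qnorm Tv z + qnorm Tv (v - vk) - qnorm Tv (vk - vb)) \<le> 0"
    unfolding 7[symmetric] 8[symmetric] using 1 2 3 by argo
  then show ?thesis
    unfolding energy_def r_def[symmetric] 6
    unfolding s_def[symmetric] z_def[symmetric] by (simp add: algebra_simps)
qed

section \<open>Unique solvability of the subproblems\<close>

lemma curv_coercive:
  assumes pos: "\<And>s z. (s, z) \<noteq> (0, 0) \<Longrightarrow> 0 < curv s z"
  obtains \<alpha> where "\<alpha> > 0" "\<And>s z. \<alpha> * (norm (s, z))\<^sup>2 \<le> curv s z"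
proof -
  have adjc: "continuous_on UNIV (\<lambda>w. adjoint F (fst w) + adjoint G (snd w))"
    using lin_adj by (intro linear_continuous_on linear_conv_bounded_linear[THEN iffD1])
      (auto intro!: linearI simp: linear_add linear_scale scaleR_add_right)
  have cont: "continuous_on UNIV (\<lambda>w. curv (fst w) (snd w))"
    unfolding curv_def hess_def using sigma
    by (intro continuous_intros adjc psd_opD(1)[OF Sf] psd_opD(1)[OF Tu] psd_opD(1)[OF Tv]
        psd_opD(1)[OF Sg]) auto
  show thesis
  proof (rule pos_homogeneous_coercive[OF cont])
    show "curv (fst (t *\<^sub>R w)) (snd (t *\<^sub>R w)) = t\<^sup>2 * curv (fst w) (snd w)" for t w
      by (simp add: curv_scaleR)
    show "0 < curv (fst w) (snd w)" if "w \<noteq> 0" for w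
      using that pos[of "fst w" "snd w"] by (simp add: prod_eq_iff)
    fix \<alpha> assume "\<alpha> > 0" "\<And>w. \<alpha> * (norm w)\<^sup>2 \<le> curv (fst w) (snd w)"
    from that[OF this(1)] this(2)[of "(_, _)"] show thesis by simp
  qed
qed

text \<open>Strong monotonicity of the subdifferential and \<open>grad_monotone\<close> pull in
  opposite directions: for two minimizers they give that \<open>\<sigma> * curv\<close> of the
  difference is at most zero.\<close>

lemma argmin_unique:
  assumes pos: "\<And>s z. (s, z) \<noteq> (0, 0) \<Longrightarrow> 0 < curv s z"
    and 1: "spalm_argmin f (quad_fun Sg b) F G c \<sigma> Tu Tv uk vk xk u1 v1"
    and 2: "spalm_argmin f (quad_fun Sg b) F G c \<sigma> Tu Tv uk vk xk u2 v2"
  shows "u1 = u2 \<and> v1 = v2"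
proof (rule ccontr)
  assume "\<not> (u1 = u2 \<and> v1 = v2)"
  then have c: "0 < curv (u1 - u2) (v1 - v2)" by (intro pos) auto
  have "qnorm Sf (u1 - u2) \<le> (- grad_u uk xk u1 v1 - - grad_u uk xk u2 v2) \<bullet> (u1 - u2)"
    by (intro mono argmin_optimality[OF 1] argmin_optimality[OF 2])
  also have "\<dots> = - ((u1 - u2) \<bullet> (grad_u uk xk u1 v1 - grad_u uk xk u2 v2))"
    by (simp add: inner_commute inner_diff_right)
  also have "\<dots> = - (\<sigma> * hess (u1 - u2) (v1 - v2))"
    using grad_monotone[of u1 u2 uk xk v1 v2 vk] argmin_optimality(2)[OF 1] argmin_optimality(2)[OF 2]
    by simp
  finally have "\<sigma> * curv (u1 - u2) (v1 - v2) \<le> 0" using sigma by (simp add: curv_def distrib_left)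
  with c sigma show False by (simp add: mult_le_0_iff)
qed

text \<open>The objective grows quadratically around \<open>(u0, 0)\<close>: \<open>f\<close>
  contributes the \<open>Sf\<close> form and the smooth part contributes \<open>hess\<close>. The
  base point is relatively interior so that \<open>f\<close> has a subgradient there.\<close>

lemma argmin_exists:
  assumes pos: "\<And>s z. (s, z) \<noteq> (0, 0) \<Longrightarrow> 0 < curv s z"
  shows "\<exists>u v. spalm_argmin f (quad_fun Sg b) F G c \<sigma> Tu Tv uk vk xk u v"
proof -
  obtain \<alpha> where alpha: "\<alpha> > 0" "\<And>s z. \<alpha> * (norm (s, z))\<^sup>2 \<le> curv s z"
    using curv_coercive[OF pos] by blast
  let ?h = "smooth_part uk vk xk"
  define \<Phi> where "\<Phi> w = f (fst w) + ereal (?h (fst w) (snd w))" for w :: "'u \<times> 'v"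
  have hcont: "continuous_on UNIV (\<lambda>w. ?h (fst w) (snd w))"
  proof -
    have 1: "continuous_on UNIV (\<lambda>w. adjoint F (fst w) + adjoint G (snd w) - c)"
      using lin_adj by (intro continuous_intros linear_continuous_on linear_conv_bounded_linear[THEN iffD1])
        (auto intro!: linearI simp: linear_add linear_scale scaleR_add_right)
    have 2: "continuous_on UNIV (\<lambda>w. quad_fun Sg b (snd w) :: real)"
      unfolding quad_fun_def qnorm_def[symmetric]
      by (intro continuous_intros psd_opD(1)[OF Sg])
    show ?thesis unfolding smooth_part_def res_def
      by (intro continuous_intros 1 2 psd_opD(1)[OF Tu] psd_opD(1)[OF Tv])
  qed
  have epi: "eepigraph \<Phi> = (\<lambda>p. (fst (fst p), snd p - ?h (fst (fst p)) (snd (fst p)))) -` eepigraph f"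
  proof (rule set_eqI)
    fix p :: "('u \<times> 'v) \<times> real"
    show "p \<in> eepigraph \<Phi> \<longleftrightarrow> p \<in> (\<lambda>p. (fst (fst p), snd p - ?h (fst (fst p)) (snd (fst p)))) -` eepigraph f"
      by (cases "f (fst (fst p))") (auto simp: eepigraph_def \<Phi>_def)
  qed
  have closed: "closed (eepigraph \<Phi>)"
    unfolding epi
    by (intro closed_vimage f_props continuous_intros continuous_on_compose2[OF hcont]) auto
  have cD: "convex (edom f)" and neD: "edom f \<noteq> {}"
    using convex_edom edom_nonempty f_props by blast+
  obtain u0 where u0: "u0 \<in> rel_interior (edom f)" using rel_interior_eq_empty[OF cD] neD by blast
  obtain \<xi> where xi: "\<xi> \<in> subdiff f u0" using rel_interior_subdiff[OF f_props(1,2) u0] by blast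
  obtain a where a: "f u0 = ereal a" using proper_edomE[OF f_props(1) subdiff_edom[OF f_props(1) xi]] .
  have w0: "\<Phi> (u0, 0) < \<infinity>" by (simp add: \<Phi>_def a)
  define g where "g = (\<xi> + grad_u uk xk u0 0, grad_v vk xk u0 0)"
  \<comment> \<open>The growth of \<open>f\<close> is available with factor 1/4 and that of the
    smooth part with \<open>\<sigma> / 2\<close>; together they dominate \<open>\<sigma> / 4\<close>
    times \<open>curv\<close>.\<close>
  define \<kappa> where "\<kappa> = \<sigma> / 4 * \<alpha>"
  have kappa: "\<kappa> > 0" using sigma alpha by (simp add: \<kappa>_def)
  have bdd: "bounded {w. \<Phi> w \<le> ereal M}" for M
  proof -
    \<comment> \<open>Bounds the solutions \<open>n\<close> of
      \<open>\<kappa> n^2 \<le> norm g * n + const\<close>: either \<open>n\<close> is at most 1, or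
      one may divide by \<open>n\<close>.\<close>
    define B where "B = 1 + (norm g + \<bar>M - a - ?h u0 0\<bar>) / \<kappa>"
    have "dist (u0, 0) w \<le> B" if w: "\<Phi> w \<le> ereal M" for w
    proof -
      define s where "s = fst w - u0"
      define z where "z = snd w"
      have weq: "fst w = u0 + s" "snd w = 0 + z" by (auto simp: s_def z_def)
      have "f u0 + ereal (\<xi> \<bullet> s + qnorm Sf s / 4) \<le> f (fst w)"
        unfolding s_def by (rule strongly_monotone_growth[OF f_props(1,2) psd_opD(1)[OF Sf] mono u0 xi])
      from add_right_mono[OF this, of "ereal (?h (fst w) (snd w))"]
      have "ereal (a + (\<xi> \<bullet> s + qnorm Sf s / 4) + ?h (fst w) (snd w)) \<le> \<Phi> w"
        by (simp add: \<Phi>_def a)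
      from order_trans[OF this w]
      have "a + (\<xi> \<bullet> s + qnorm Sf s / 4) + ?h (fst w) (snd w) \<le> M" by simp
      then have le: "a + ?h u0 0 + g \<bullet> (s, z) + (qnorm Sf s / 4 + \<sigma> / 2 * hess s z) \<le> M"
        unfolding weq smooth_part_add by (simp add: g_def inner_add_left inner_add_right inner_commute)
      have "\<kappa> * (norm (s, z))\<^sup>2 \<le> \<sigma> / 4 * curv s z"
        unfolding \<kappa>_def mult.assoc using alpha sigma by (intro mult_left_mono) auto
      also have "\<dots> \<le> qnorm Sf s / 4 + \<sigma> / 2 * hess s z"
        using hess_nonneg[of s z] sigma by (simp add: curv_def field_simps)
      finally have "\<kappa> * (norm (s, z))\<^sup>2 + g \<bullet> (s, z) \<le> M - a - ?h u0 0" using le by linarith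
      moreover have "- (norm g * norm (s, z)) \<le> g \<bullet> (s, z)"
        using Cauchy_Schwarz_ineq2[of g "(s, z)"] by linarith
      ultimately have q: "\<kappa> * (norm (s, z))\<^sup>2 \<le> norm g * norm (s, z) + \<bar>M - a - ?h u0 0\<bar>"
        by linarith
      have "norm (s, z) \<le> B"
      proof (cases "norm (s, z) \<le> 1")
        case True
        then show ?thesis using kappa by (simp add: B_def add_increasing2)
      next
        case False
        then have n: "1 < norm (s, z)" by simp
        have "\<bar>M - a - ?h u0 0\<bar> * 1 \<le> \<bar>M - a - ?h u0 0\<bar> * norm (s, z)"
          using n by (intro mult_left_mono) auto
        with q have "norm (s, z) * (\<kappa> * norm (s, z)) \<le> norm (s, z) * (norm g + \<bar>M - a - ?h u0 0\<bar>)"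
          by (simp add: power2_eq_square algebra_simps)
        then have "\<kappa> * norm (s, z) \<le> norm g + \<bar>M - a - ?h u0 0\<bar>"
          using n by (subst (asm) mult_le_cancel_left_pos) auto
        then have "norm (s, z) \<le> (norm g + \<bar>M - a - ?h u0 0\<bar>) / \<kappa>"
          using kappa by (simp add: field_simps)
        then show ?thesis by (simp add: B_def)
      qed
      moreover have "dist w (u0, 0) = norm (s, z)"
        by (simp add: dist_norm s_def z_def minus_prod_def)
      ultimately show ?thesis by (simp add: dist_commute)
    qed
    then show ?thesis unfolding bounded_def by blast
  qed
  obtain w where "\<And>y. \<Phi> w \<le> \<Phi> y"
    using argmin_exists_of_bounded_sublevels[OF closed w0 bdd] by blast
  then have "\<Phi> (fst w, snd w) \<le> \<Phi> (u, v)" for u v by simp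
  then have "spalm_argmin f (quad_fun Sg b) F G c \<sigma> Tu Tv uk vk xk (fst w) (snd w)"
    by (simp add: spalm_argmin_def spalm_sub_eq \<Phi>_def)
  then show ?thesis by blast
qed

end

section \<open>Convergence\<close>

locale prox_alm_seq = prox_alm +
  fixes \<tau> :: real and u :: "nat \<Rightarrow> 'a" and v :: "nat \<Rightarrow> 'b" and x :: "nat \<Rightarrow> 'c"
  assumes tau: "\<tau> > 0"
    and seq: "scb_spalm_seq f (quad_fun Sg b) F G c \<sigma> \<tau> Tu Tv u v x"
    and tau_cases: "\<tau> < 2 \<or> summable (\<lambda>k. (norm (res (u (Suc k)) (v (Suc k))))\<^sup>2)"
begin

lemma seq_argmin: "spalm_argmin f (quad_fun Sg b) F G c \<sigma> Tu Tv (u k) (v k) (x k) (u (Suc k)) (v (Suc k))"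
  and seq_x: "x (Suc k) = x k + (\<tau> * \<sigma>) *\<^sub>R res (u (Suc k)) (v (Suc k))"
  using seq by (auto simp: scb_spalm_seq_def res_def)

lemma energy_nonneg: "0 \<le> energy \<tau> ub vb xb u' v' x'"
  using tau sigma psd_opD(3)[OF Tu] psd_opD(3)[OF Tv] by (simp add: energy_def)

text \<open>For \<open>\<tau> \<ge> 2\<close> the energy need not decrease, but its growth \<open>(\<tau> - 2) \<sigma> \<parallel>res\<parallel>\<^sup>2\<close> is summable by
  assumption, hence quasi-Fejer monotonicity.\<close>

lemma fejer:
  assumes kkt: "kkt ub vb xb"
  shows "convergent (\<lambda>k. energy \<tau> ub vb xb (u k) (v k) (x k))"
    and "(\<lambda>k. norm (res (u (Suc k)) (v (Suc k)))) \<longlonglongrightarrow> 0"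
    and "(\<lambda>k. qnorm Tu (u (Suc k) - u k)) \<longlonglongrightarrow> 0"
    and "(\<lambda>k. qnorm Tv (v (Suc k) - v k)) \<longlonglongrightarrow> 0"
    and "(\<lambda>k. qnorm Sf (u (Suc k) - ub)) \<longlonglongrightarrow> 0"
    and "(\<lambda>k. qnorm Sg (v (Suc k) - vb)) \<longlonglongrightarrow> 0"
proof -
  define \<rho> where "\<rho> k = (norm (res (u (Suc k)) (v (Suc k))))\<^sup>2" for k
  define E where "E k = energy \<tau> ub vb xb (u k) (v k) (x k)" for k
  \<comment> \<open>The coefficient \<open>2 - \<tau>\<close> is split into its positive part, a
    decrease kept in \<open>d\<close>, and its negative part, an error put into
    \<open>e\<close>.\<close>
  define d where "d k = max (2 - \<tau>) 0 * \<sigma> * \<rho> k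
     + \<sigma> * (qnorm Tu (u (Suc k) - u k) + qnorm Tv (v (Suc k) - v k))
     + 2 * (qnorm Sf (u (Suc k) - ub) + qnorm Sg (v (Suc k) - vb))" for k
  define e where "e k = max (\<tau> - 2) 0 * \<sigma> * \<rho> k" for k
  note nn = psd_opD(3)[OF Tu] psd_opD(3)[OF Tv] psd_opD(3)[OF Sf] psd_opD(3)[OF Sg]
  have rho: "0 \<le> \<rho> k" for k by (simp add: \<rho>_def)
  have max_eq: "max (2 - \<tau>) 0 - max (\<tau> - 2) 0 = 2 - \<tau>" by auto
  have step: "E (Suc k) + d k \<le> E k + e k" for k
  proof -
    have "max (2 - \<tau>) 0 * \<sigma> * \<rho> k - max (\<tau> - 2) 0 * \<sigma> * \<rho> k = (2 - \<tau>) * \<sigma> * \<rho> k"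
      using arg_cong[OF max_eq, of "\<lambda>m. m * \<sigma> * \<rho> k"] by (simp only: left_diff_distrib)
    with energy_descent[OF tau kkt seq_argmin[of k]]
    show ?thesis unfolding E_def d_def e_def seq_x \<rho>_def[symmetric] by linarith
  qed
  have d0: "0 \<le> d k" for k using sigma rho nn by (simp add: d_def)
  have e0: "0 \<le> e k" for k using sigma rho by (simp add: e_def)
  have se: "summable e"
  proof (cases "\<tau> < 2")
    case True
    then show ?thesis by (simp add: e_def[abs_def])
  next
    case False
    then have "summable \<rho>" using tau_cases by (simp add: \<rho>_def[abs_def])
    then show ?thesis unfolding e_def[abs_def] by (rule summable_mult)
  qed
  have E0: "0 \<le> E k" for k by (simp add: E_def energy_nonneg)
  show "convergent (\<lambda>k. energy \<tau> ub vb xb (u k) (v k) (x k))"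
    using quasi_fejer(2)[of E d e, OF step E0 d0 e0 se] by (simp add: E_def[abs_def])
  have d: "d \<longlonglongrightarrow> 0"
    using quasi_fejer(1)[of E d e, OF step E0 d0 e0 se] by (rule summable_LIMSEQ_zero)
  have dom: "q \<longlonglongrightarrow> 0" if q: "\<And>k. 0 \<le> q k" "\<And>k. C * q k \<le> d k" "C > 0" for q :: "nat \<Rightarrow> real" and C
  proof (rule tendsto_sandwich[of "\<lambda>_. 0" _ _ "\<lambda>k. d k / C"])
    show "(\<lambda>k. d k / C) \<longlonglongrightarrow> 0" using tendsto_divide[OF d tendsto_const[of C]] q(3) by simp
    show "\<forall>\<^sub>F k in sequentially. q k \<le> d k / C" using q(2,3) by (simp add: field_simps)
  qed (use q in auto)
  \<comment> \<open>For \<tau> at least 2 the decrease \<open>d\<close> does not control the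
    residual, which then vanishes by the summability assumption.\<close>
  have "\<rho> \<longlonglongrightarrow> 0"
  proof (cases "\<tau> < 2")
    case True
    show ?thesis
    proof (rule dom[where C = "(2 - \<tau>) * \<sigma>"])
      show "(2 - \<tau>) * \<sigma> * \<rho> k \<le> d k" for k using True nn sigma by (simp add: d_def)
    qed (use True sigma rho in auto)
  next
    case False
    then have "summable \<rho>" using tau_cases by (simp add: \<rho>_def[abs_def])
    then show ?thesis by (rule summable_LIMSEQ_zero)
  qed
  then have "(\<lambda>k. sqrt (\<rho> k)) \<longlonglongrightarrow> sqrt 0" by (rule tendsto_real_sqrt)
  then show "(\<lambda>k. norm (res (u (Suc k)) (v (Suc k)))) \<longlonglongrightarrow> 0" by (simp add: \<rho>_def)
  have p: "0 \<le> max (2 - \<tau>) 0 * \<sigma> * \<rho> k" for k using sigma rho by simp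
  show "(\<lambda>k. qnorm Tu (u (Suc k) - u k)) \<longlonglongrightarrow> 0" "(\<lambda>k. qnorm Tv (v (Suc k) - v k)) \<longlonglongrightarrow> 0"
    by (rule dom[where C = \<sigma>]; use nn sigma p in \<open>simp add: d_def distrib_left add_increasing add_increasing2\<close>)+
  show "(\<lambda>k. qnorm Sf (u (Suc k) - ub)) \<longlonglongrightarrow> 0" "(\<lambda>k. qnorm Sg (v (Suc k) - vb)) \<longlonglongrightarrow> 0"
    by (rule dom[where C = 2]; use nn sigma p in \<open>simp add: d_def distrib_left add_increasing add_increasing2\<close>)+
qed

text \<open>The optimality conditions of a step contain the previous \<open>u\<close> and
  \<open>v\<close> only through the images of the increments under \<open>Tu\<close> and
  \<open>Tv\<close>, which vanish; so the previous iterates need not converge. The given KKT triple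
  only makes \<open>fejer\<close> available.\<close>

lemma cluster_kkt:
  assumes kkt: "kkt ub vb xb" and r: "strict_mono r"
    and lim: "(\<lambda>k. (u (r k), v (r k), x (r k))) \<longlonglongrightarrow> (ua, va, xa)"
  shows "kkt ua va xa"
proof -
  \<comment> \<open>Index of the step that produces the iterate \<open>r (Suc k)\<close>. The first
    term of the subsequence is dropped because it may be the starting point, which no step
    produces.\<close>
  define n where "n k = r (Suc k) - 1" for k
  have r1: "r (Suc k) = Suc (n k)" for k
    using strict_mono_imp_increasing[OF r, of "Suc k"] by (simp add: n_def)
  have n: "filterlim n at_top sequentially"
  proof (rule filterlim_at_top_mono[OF filterlim_ident])
    show "\<forall>\<^sub>F k in sequentially. k \<le> n k"
      using strict_mono_imp_increasing[OF r] r1 by (metis Suc_le_mono always_eventually)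
  qed
  have lim': "(\<lambda>k. (u (Suc (n k)), v (Suc (n k)), x (Suc (n k)))) \<longlonglongrightarrow> (ua, va, xa)"
    using LIMSEQ_Suc[OF lim] by (simp add: r1)
  have lu: "(\<lambda>k. u (Suc (n k))) \<longlonglongrightarrow> ua" using tendsto_fst[OF lim'] by simp
  have lv: "(\<lambda>k. v (Suc (n k))) \<longlonglongrightarrow> va" using tendsto_fst[OF tendsto_snd[OF lim']] by simp
  have lx: "(\<lambda>k. x (Suc (n k))) \<longlonglongrightarrow> xa" using tendsto_snd[OF tendsto_snd[OF lim']] by simp
  note lin_tendsto = bounded_linear.tendsto[OF linear_conv_bounded_linear[THEN iffD1]]
  let ?r = "\<lambda>k. res (u (Suc (n k))) (v (Suc (n k)))"
  have lr: "?r \<longlonglongrightarrow> 0"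
    using filterlim_compose[OF fejer(2)[OF kkt] n] by (simp add: tendsto_norm_zero_iff)
  have "?r \<longlonglongrightarrow> res ua va" unfolding res_def
    by (intro tendsto_intros lin_tendsto[OF lin_adj(1)] lin_tendsto[OF lin_adj(2)] lu lv)
  with lr have res: "res ua va = 0" using LIMSEQ_unique by blast
  have psd_lim: "(\<lambda>k. T (w k)) \<longlonglongrightarrow> 0"
    if T: "psd_op T" and w: "(\<lambda>k. qnorm T (w k)) \<longlonglongrightarrow> 0" for T :: "'z::euclidean_space \<Rightarrow> 'z" and w :: "nat \<Rightarrow> 'z"
  proof -
    obtain B where B: "\<And>w. (norm (T w))\<^sup>2 \<le> B * qnorm T w" using psd_norm_bound[OF T] by blast
    have "(\<lambda>k. (norm (T (w k)))\<^sup>2) \<longlonglongrightarrow> 0"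
    proof (rule tendsto_sandwich[of "\<lambda>_. 0" _ _ "\<lambda>k. B * qnorm T (w k)"])
      show "(\<lambda>k. B * qnorm T (w k)) \<longlonglongrightarrow> 0" using tendsto_mult[OF tendsto_const[of B] w] by simp
    qed (use B in auto)
    then have "(\<lambda>k. sqrt ((norm (T (w k)))\<^sup>2)) \<longlonglongrightarrow> sqrt 0" by (rule tendsto_real_sqrt)
    then show ?thesis by (simp add: tendsto_norm_zero_iff)
  qed
  have lTu: "(\<lambda>k. Tu (u (Suc (n k)) - u (n k))) \<longlonglongrightarrow> 0"
    by (rule psd_lim[OF Tu filterlim_compose[OF fejer(3)[OF kkt] n]])
  have lTv: "(\<lambda>k. Tv (v (Suc (n k)) - v (n k))) \<longlonglongrightarrow> 0"
    by (rule psd_lim[OF Tv filterlim_compose[OF fejer(4)[OF kkt] n]])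
  \<comment> \<open>Undo the multiplier update to express the shifted multiplier of the step through
    the convergent new iterate.\<close>
  have "(\<lambda>k. x (Suc (n k)) - (\<tau> * \<sigma>) *\<^sub>R ?r k + \<sigma> *\<^sub>R ?r k) \<longlonglongrightarrow> xa - (\<tau> * \<sigma>) *\<^sub>R 0 + \<sigma> *\<^sub>R 0"
    by (intro tendsto_intros lx lr)
  then have ly: "(\<lambda>k. x (n k) + \<sigma> *\<^sub>R ?r k) \<longlonglongrightarrow> xa" by (simp add: seq_x)
  have "(\<lambda>k. - grad_u (u (n k)) (x (n k)) (u (Suc (n k))) (v (Suc (n k)))) \<longlonglongrightarrow> - (F xa + \<sigma> *\<^sub>R 0)"
    unfolding grad_u_def by (intro tendsto_intros lin_tendsto[OF F] ly lTu)
  then have "- (F xa + \<sigma> *\<^sub>R 0) \<in> subdiff f ua"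
    using argmin_optimality(1)[OF seq_argmin] by (intro subdiff_closed[OF f_props(1,3) _ lu])
  then have 1: "- F xa \<in> subdiff f ua" by simp
  have "(\<lambda>k. grad_v (v (n k)) (x (n k)) (u (Suc (n k))) (v (Suc (n k)))) \<longlonglongrightarrow> Sg va - b + G xa + \<sigma> *\<^sub>R 0"
    unfolding grad_v_def by (intro tendsto_intros lin_tendsto[OF G] lin_tendsto[OF psd_opD(1)[OF Sg]] lv ly lTv)
  then have "(\<lambda>k::nat. 0) \<longlonglongrightarrow> Sg va - b + G xa + \<sigma> *\<^sub>R 0"
    by (simp only: argmin_optimality(2)[OF seq_argmin])
  then have "Sg va - b + G xa = 0" by (simp add: LIMSEQ_const_iff)
  with 1 res show ?thesis by (simp add: kkt_def)
qed

text \<open>Feasibility of the KKT pair turns the mixed term of \<open>curv\<close> into the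
  residual, and the energy covers the proximal seminorms. By \<open>fejer\<close> the other terms on
  the right tend to zero.\<close>

lemma curv_le_energy:
  assumes kkt: "kkt ub vb xb"
  shows "curv (u k - ub) (v k - vb) \<le> qnorm Sf (u k - ub) / \<sigma> + (norm (res (u k) (v k)))\<^sup>2
      + qnorm Sg (v k - vb) / \<sigma> + energy \<tau> ub vb xb (u k) (v k) (x k) / \<sigma>"
proof -
  have "adjoint F (u k - ub) + adjoint G (v k - vb) = res (u k) (v k)"
    using kkt res_add[of ub "u k - ub" vb "v k - vb"] by (simp add: kkt_def)
  then show ?thesis using sigma tau by (simp add: curv_def hess_def energy_def add_divide_distrib)
qed

lemma norm_x_le_energy: "(norm (x k - xb))\<^sup>2 \<le> \<tau> * \<sigma> * energy \<tau> ub vb xb (u k) (v k) (x k)"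
  using sigma tau psd_opD(3)[OF Tu] psd_opD(3)[OF Tv] by (simp add: energy_def distrib_left)

lemma converges:
  assumes pos: "\<And>s z. (s, z) \<noteq> (0, 0) \<Longrightarrow> 0 < curv s z" and kkt: "kkt ub vb xb"
  shows "\<exists>ua va xa. (\<lambda>k. (u k, v k, x k)) \<longlonglongrightarrow> (ua, va, xa) \<and> kkt ua va xa"
proof -
  obtain \<alpha> where alpha: "\<alpha> > 0" "\<And>s z. \<alpha> * (norm (s, z))\<^sup>2 \<le> curv s z"
    using curv_coercive[OF pos] by blast
  \<comment> \<open>Kept general in the triple: the given one yields boundedness, the accumulation
    point yields convergence. Indices are shifted because \<open>fejer\<close> controls the residual
    only from the first computed iterate on.\<close>
  define R where "R ub vb xb k = qnorm Sf (u (Suc k) - ub) / \<sigma> + (norm (res (u (Suc k)) (v (Suc k))))\<^sup>2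
      + qnorm Sg (v (Suc k) - vb) / \<sigma> + energy \<tau> ub vb xb (u (Suc k)) (v (Suc k)) (x (Suc k)) / \<sigma>"
    for ub vb xb k
  have R_lim: "R ub vb xb \<longlonglongrightarrow> L / \<sigma>"
    if "kkt ub vb xb" "(\<lambda>k. energy \<tau> ub vb xb (u k) (v k) (x k)) \<longlonglongrightarrow> L" for ub vb xb L
  proof -
    have "R ub vb xb \<longlonglongrightarrow> 0 / \<sigma> + 0\<^sup>2 + 0 / \<sigma> + L / \<sigma>"
      unfolding R_def[abs_def]
      by (intro tendsto_intros fejer[OF that(1)] LIMSEQ_Suc[OF that(2)]) (use sigma in auto)
    then show ?thesis by simp
  qed
  have w_le: "(norm (u (Suc k) - ub, v (Suc k) - vb))\<^sup>2 \<le> R ub vb xb k / \<alpha>"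
    if "kkt ub vb xb" for ub vb xb k
  proof -
    have "\<alpha> * (norm (u (Suc k) - ub, v (Suc k) - vb))\<^sup>2 \<le> R ub vb xb k"
      unfolding R_def by (rule order_trans[OF alpha(2) curv_le_energy[OF that]])
    then show ?thesis using alpha(1) by (simp add: field_simps)
  qed
  let ?W = "\<lambda>k. ((u (Suc k), v (Suc k)), x (Suc k))"
  have dist_le: "(dist (?W k) ((ub, vb), xb))\<^sup>2
      \<le> R ub vb xb k / \<alpha> + \<tau> * \<sigma> * energy \<tau> ub vb xb (u (Suc k)) (v (Suc k)) (x (Suc k))"
    if "kkt ub vb xb" for ub vb xb k
  proof -
    have "(dist (?W k) ((ub, vb), xb))\<^sup>2
        = (norm (u (Suc k) - ub, v (Suc k) - vb))\<^sup>2 + (norm (x (Suc k) - xb))\<^sup>2"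
      by (simp add: dist_norm norm_Pair)
    then show ?thesis using w_le[OF that, of k] norm_x_le_energy[of "Suc k" xb ub vb] by linarith
  qed
  have lim0: "?W \<longlonglongrightarrow> ((ub, vb), xb)"
    if k: "kkt ub vb xb" and E: "(\<lambda>k. energy \<tau> ub vb xb (u k) (v k) (x k)) \<longlonglongrightarrow> 0" for ub vb xb
  proof -
    have "(\<lambda>k. R ub vb xb k / \<alpha> + \<tau> * \<sigma> * energy \<tau> ub vb xb (u (Suc k)) (v (Suc k)) (x (Suc k)))
        \<longlonglongrightarrow> (0 / \<sigma>) / \<alpha> + \<tau> * \<sigma> * 0"
      by (intro tendsto_intros R_lim[OF k E] LIMSEQ_Suc[OF E]) (use alpha in auto)
    then have lim: "(\<lambda>k. R ub vb xb k / \<alpha>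
        + \<tau> * \<sigma> * energy \<tau> ub vb xb (u (Suc k)) (v (Suc k)) (x (Suc k))) \<longlonglongrightarrow> 0"
      by simp
    have "(\<lambda>k. (dist (?W k) ((ub, vb), xb))\<^sup>2) \<longlonglongrightarrow> 0"
      by (rule tendsto_sandwich[OF _ _ tendsto_const lim])
        (intro always_eventually allI zero_le_power2, intro always_eventually allI dist_le[OF k])
    then have "(\<lambda>k. sqrt ((dist (?W k) ((ub, vb), xb))\<^sup>2)) \<longlonglongrightarrow> sqrt 0" by (rule tendsto_real_sqrt)
    then show ?thesis by (simp add: tendsto_dist_iff[of ?W])
  qed
  obtain L where L: "(\<lambda>k. energy \<tau> ub vb xb (u k) (v k) (x k)) \<longlonglongrightarrow> L"
    using fejer(1)[OF kkt] by (auto simp: convergent_def)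
  have "(\<lambda>k. R ub vb xb k / \<alpha> + \<tau> * \<sigma> * energy \<tau> ub vb xb (u (Suc k)) (v (Suc k)) (x (Suc k)))
      \<longlonglongrightarrow> (L / \<sigma>) / \<alpha> + \<tau> * \<sigma> * L"
    by (intro tendsto_intros R_lim[OF kkt L] LIMSEQ_Suc[OF L]) (use alpha in auto)
  then obtain K where K: "\<And>k. R ub vb xb k / \<alpha>
      + \<tau> * \<sigma> * energy \<tau> ub vb xb (u (Suc k)) (v (Suc k)) (x (Suc k)) \<le> K"
    using convergent_imp_Bseq[unfolded convergent_def, OF exI] Bseq_def
    by (metis (no_types, lifting) BseqD abs_le_D1 real_norm_def)
  have "bounded (range ?W)"
    unfolding bounded_def
  proof (intro exI ballI)
    fix p assume "p \<in> range ?W"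
    then obtain k where p: "p = ?W k" by blast
    have "(dist ((ub, vb), xb) p)\<^sup>2 \<le> K"
      using order_trans[OF dist_le[OF kkt] K, of k] by (simp add: p dist_commute)
    then show "dist ((ub, vb), xb) p \<le> sqrt K" by (rule real_le_rsqrt)
  qed
  then obtain l r where r: "strict_mono r" "(?W \<circ> r) \<longlonglongrightarrow> l"
    using bounded_imp_convergent_subsequence by blast
  obtain ua va xa where l: "l = ((ua, va), xa)" by (metis prod.exhaust)
  define r' where "r' k = Suc (r k)" for k
  have r': "strict_mono r'" using r(1) by (auto simp: strict_mono_def r'_def)
  have W: "(\<lambda>k. ((u (r' k), v (r' k)), x (r' k))) \<longlonglongrightarrow> ((ua, va), xa)"
    using r(2) by (simp add: l o_def r'_def)
  have lu: "(\<lambda>k. u (r' k)) \<longlonglongrightarrow> ua" using tendsto_fst[OF tendsto_fst[OF W]] by simp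
  have lv: "(\<lambda>k. v (r' k)) \<longlonglongrightarrow> va" using tendsto_snd[OF tendsto_fst[OF W]] by simp
  have lx: "(\<lambda>k. x (r' k)) \<longlonglongrightarrow> xa" using tendsto_snd[OF W] by simp
  have kkt': "kkt ua va xa"
    by (rule cluster_kkt[OF kkt r']) (intro tendsto_Pair lu lv lx)
  \<comment> \<open>The energy relative to the accumulation point has a limit along the whole
    sequence, and the subsequence identifies this limit as zero.\<close>
  obtain L' where L': "(\<lambda>k. energy \<tau> ua va xa (u k) (v k) (x k)) \<longlonglongrightarrow> L'"
    using fejer(1)[OF kkt'] by (auto simp: convergent_def)
  have "(\<lambda>k. energy \<tau> ua va xa (u (r' k)) (v (r' k)) (x (r' k))) \<longlonglongrightarrow> energy \<tau> ua va xa ua va xa"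
    unfolding energy_def qnorm_def
    by (intro tendsto_intros lu lv lx
        bounded_linear.tendsto[OF linear_conv_bounded_linear[THEN iffD1, OF psd_opD(1)[OF Tu]]]
        bounded_linear.tendsto[OF linear_conv_bounded_linear[THEN iffD1, OF psd_opD(1)[OF Tv]]])
      (use tau sigma in auto)
  moreover have "energy \<tau> ua va xa ua va xa = 0" by (simp add: energy_def qnorm_def)
  ultimately have "(\<lambda>k. energy \<tau> ua va xa (u (r' k)) (v (r' k)) (x (r' k))) \<longlonglongrightarrow> 0" by simp
  moreover have "(\<lambda>k. energy \<tau> ua va xa (u (r' k)) (v (r' k)) (x (r' k))) \<longlonglongrightarrow> L'"
    using LIMSEQ_subseq_LIMSEQ[OF L' r'] by (simp add: o_def)
  ultimately have "L' = 0" by (rule LIMSEQ_unique[symmetric])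
  with L' have "?W \<longlonglongrightarrow> ((ua, va), xa)" by (intro lim0[OF kkt']) simp
  then have "(\<lambda>k. (u (Suc k), v (Suc k), x (Suc k))) \<longlonglongrightarrow> (ua, va, xa)"
    using tendsto_fst[THEN tendsto_fst] tendsto_fst[THEN tendsto_snd] tendsto_snd
    by (intro tendsto_Pair) fastforce+
  then have "(\<lambda>k. (u k, v k, x k)) \<longlonglongrightarrow> (ua, va, xa)" by (rule LIMSEQ_imp_Suc)
  with kkt' show ?thesis by blast
qed

end

text \<open>Well-definedness appears as unique solvability for every proximal centre, from which the
  iterates arise by recursion. Accumulation points are expressed as limits of subsequences.\<close>

theorem theorem2p2:
  fixes f :: "'u::euclidean_space \<Rightarrow> ereal"
    and Sg :: "'v::euclidean_space \<Rightarrow> 'v" and b :: "'v"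
    and F :: "'x::euclidean_space \<Rightarrow> 'u" and G :: "'x \<Rightarrow> 'v" and c :: "'x"
    and Sf :: "'u \<Rightarrow> 'u" and Tf :: "'u \<Rightarrow> 'u" and Eg :: "'v \<Rightarrow> 'v"
    and \<sigma> \<tau> :: real
    and u :: "nat \<Rightarrow> 'u" and v :: "nat \<Rightarrow> 'v" and x :: "nat \<Rightarrow> 'x"
  defines "g \<equiv> quad_fun Sg b"
    and "Tg \<equiv> (\<lambda>w. Eg w - (1 / \<sigma>) *\<^sub>R Sg w - G (adjoint G w))"
    and "Thf \<equiv> (\<lambda>w. Tf w + F (adjoint G (inv Eg (G (adjoint F w)))))"
  assumes f_cpc: "closed_proper_convex f"
    and Sg_psd: "psd_op Sg"
    and F_lin: "linear F" and G_lin: "linear G"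
    and Sf_psd: "psd_op Sf"
    and Sf_mono: "\<forall>u1\<in>edom f. \<forall>u2\<in>edom f. \<forall>\<xi>1\<in>subdiff f u1. \<forall>\<xi>2\<in>subdiff f u2.
                     qnorm Sf (u1 - u2) \<le> (\<xi>1 - \<xi>2) \<bullet> (u1 - u2)"
    and sigma_pos: "\<sigma> > 0" and tau_pos: "\<tau> > 0"
    and Eg_pd: "pd_op Eg" and Tg_psd: "psd_op Tg"
    and Tf_psd: "psd_op Tf"
    and P_solvable: "\<exists>u' v'. solves_P f g F G c u' v'"
    and slater: "\<exists>uh vh. uh \<in> rel_interior (edom f) \<and> P_feasible F G c uh vh"
    and seq: "scb_spalm_seq f g F G c \<sigma> \<tau> Thf Tg u v x"
    and tau_cases: "\<tau> < 2 \<or>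
        (\<tau> \<ge> 2 \<and> summable (\<lambda>k. (norm (adjoint F (u (Suc k)) + adjoint G (v (Suc k)) - c))\<^sup>2))"
  shows
    "(\<forall>ua va xa. (\<exists>r. strict_mono r \<and> ((\<lambda>k. (u (r k), v (r k), x (r k))) \<longlonglongrightarrow> (ua, va, xa)))
        \<longrightarrow> solves_P f g F G c ua va \<and> solves_D f g F G c xa)
     \<and>
     ((\<forall>w. w \<noteq> 0 \<longrightarrow> 0 < w \<bullet> ((1 / \<sigma>) *\<^sub>R Sf w + Tf w + F (adjoint F w))) \<longrightarrow>
        (\<forall>uk vk xk. \<exists>!p. spalm_argmin f g F G c \<sigma> Thf Tg uk vk xk (fst p) (snd p))
        \<and> (\<exists>ua va xa. ((\<lambda>k. (u k, v k, x k)) \<longlonglongrightarrow> (ua, va, xa))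
              \<and> solves_P f g F G c ua va \<and> solves_D f g F G c xa))"
proof -
  have proper: "proper_fun f" using f_cpc by (simp add: closed_proper_convex_def)
  \<comment> \<open>Exhibits the additional term of \<open>Thf\<close> as a congruence of the
    inverse of \<open>Eg\<close>, hence as semidefinite.\<close>
  define H where "H = (\<lambda>y. F (adjoint G y))"
  have H: "linear H" unfolding H_def
    using linear_compose[OF adjoint_linear[OF G_lin] F_lin] by (simp add: o_def)
  have H': "adjoint H = (\<lambda>w. G (adjoint F w))"
    by (rule adjoint_unique) (metis F_lin G_lin H_def adjoint_works inner_commute)
  have Thf_eq: "Thf = (\<lambda>w. Tf w + H (inv Eg (adjoint H w)))"
    unfolding Thf_def H' unfolding H_def ..
  have Thf_psd: "psd_op Thf"
    unfolding Thf_eq by (intro psd_op_add Tf_psd psd_op_congruence H psd_op_inv Eg_pd)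
  interpret prox_alm f Sg b F G c Sf Thf Tg \<sigma>
  proof (rule prox_alm.intro)
    fix u1 u2 \<xi>1 \<xi>2 assume "\<xi>1 \<in> subdiff f u1" "\<xi>2 \<in> subdiff f u2"
    then show "qnorm Sf (u1 - u2) \<le> (\<xi>1 - \<xi>2) \<bullet> (u1 - u2)"
      using Sf_mono subdiff_edom[OF proper] by blast
  qed fact+
  interpret prox_alm_seq f Sg b F G c Sf Thf Tg \<sigma> \<tau> u v x
  proof (rule prox_alm_seq.intro[OF prox_alm_axioms], rule prox_alm_seq_axioms.intro)
    show "scb_spalm_seq f (quad_fun Sg b) F G c \<sigma> \<tau> Thf Tg u v x" using seq by (simp only: g_def)
    show "\<tau> < 2 \<or> summable (\<lambda>k. (norm (res (u (Suc k)) (v (Suc k))))\<^sup>2)"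
      using tau_cases unfolding res_def by blast
  qed fact
  obtain ub vb xb where kkt: "kkt ub vb xb"
    using P_solvable slater kkt_exists unfolding g_def by blast
  have pos: "0 < curv s z"
    if pd: "\<forall>w. w \<noteq> 0 \<longrightarrow> 0 < w \<bullet> ((1 / \<sigma>) *\<^sub>R Sf w + Tf w + F (adjoint F w))"
      and ne: "(s, z) \<noteq> (0, 0)" for s z
  proof -
    \<comment> \<open>completing the square in \<open>z\<close>: the Schur complement of the \<open>Eg\<close>-block is \<open>Sf/\<sigma> + Tf + F F\<^sup>*\<close>\<close>
    define p where "p = inv Eg (G (adjoint F s))"
    have E_psd: "psd_op Eg" by (rule pd_op_imp_psd_op[OF Eg_pd])
    have Ep: "Eg p = G (adjoint F s)"
      unfolding p_def by (rule surj_f_inv_f[OF bij_is_surj[OF pd_op_bij[OF Eg_pd]]])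
    have F': "w \<bullet> F y = adjoint F w \<bullet> y" for w y
      using adjoint_works[OF F_lin, of y w] by (simp add: inner_commute)
    have G': "w \<bullet> G y = adjoint G w \<bullet> y" for w y
      using adjoint_works[OF G_lin, of y w] by (simp add: inner_commute)
    have Thf: "qnorm Thf s = s \<bullet> Tf s + qnorm Eg p"
    proof -
      have "s \<bullet> F (adjoint G p) = G (adjoint F s) \<bullet> p"
        using F'[of s "adjoint G p"] adjoint_works[OF G_lin, of "adjoint F s" p] by simp
      then show ?thesis
        by (simp add: qnorm_def Thf_def inner_add_right Ep inner_commute flip: p_def)
    qed
    have Tg: "qnorm Tg z = qnorm Eg z - qnorm Sg z / \<sigma> - (norm (adjoint G z))\<^sup>2"
      by (simp add: qnorm_def Tg_def inner_diff_right G' power2_norm_eq_inner)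
    \<comment> \<open>The coupling in the squared norm is exactly the cross term of
      \<open>qnorm Eg (p + z)\<close>; the other two terms of that square come from
      \<open>Thf\<close> and from \<open>Tg\<close>.\<close>
    have cross: "z \<bullet> Eg p = adjoint F s \<bullet> adjoint G z"
      by (simp add: Ep G' inner_commute)
    have n: "(norm (adjoint F s + adjoint G z))\<^sup>2
        = (norm (adjoint F s))\<^sup>2 + 2 * (adjoint F s \<bullet> adjoint G z) + (norm (adjoint G z))\<^sup>2"
      by (simp add: power2_norm_eq_inner inner_add_left inner_add_right inner_commute)
    have "s \<bullet> ((1 / \<sigma>) *\<^sub>R Sf s + Tf s + F (adjoint F s))
        = qnorm Sf s / \<sigma> + s \<bullet> Tf s + (norm (adjoint F s))\<^sup>2"
      by (simp add: inner_add_right qnorm_def F' power2_norm_eq_inner)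
    then have eq: "curv s z = s \<bullet> ((1 / \<sigma>) *\<^sub>R Sf s + Tf s + F (adjoint F s)) + qnorm Eg (p + z)"
      unfolding curv_def hess_def n Thf Tg qnorm_add[OF E_psd] cross by simp
    show ?thesis
    proof (cases "s = 0")
      case True
      then have "z \<noteq> 0" using ne by simp
      moreover have "p = 0" unfolding p_def True
        using linear_0[OF adjoint_linear[OF F_lin]] linear_0[OF G_lin]
          linear_0[OF psd_opD(1)[OF psd_op_inv[OF Eg_pd]]] by simp
      ultimately have "0 < qnorm Eg (p + z)" using Eg_pd by (simp add: pd_op_def qnorm_def)
      then show ?thesis unfolding eq using True by simp
    next
      case False
      then have "0 < s \<bullet> ((1 / \<sigma>) *\<^sub>R Sf s + Tf s + F (adjoint F s))" using pd by blast
      then show ?thesis using psd_opD(3)[OF E_psd, of "p + z"] by (simp add: eq)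
    qed
  qed
  show ?thesis
  proof (intro conjI allI impI)
    fix ua va xa
    assume "\<exists>r. strict_mono r \<and> (\<lambda>k. (u (r k), v (r k), x (r k))) \<longlonglongrightarrow> (ua, va, xa)"
    then have "kkt ua va xa" using cluster_kkt[OF kkt] by blast
    then show "solves_P f g F G c ua va" "solves_D f g F G c xa"
      unfolding g_def by (rule kkt_solves_P kkt_solves_D)+
  next
    fix uk vk xk
    assume pd: "\<forall>w. w \<noteq> 0 \<longrightarrow> 0 < w \<bullet> ((1 / \<sigma>) *\<^sub>R Sf w + Tf w + F (adjoint F w))"
    obtain u1 v1 where "spalm_argmin f g F G c \<sigma> Thf Tg uk vk xk u1 v1"
      using argmin_exists[OF pos[OF pd]] unfolding g_def by blast
    then show "\<exists>!p. spalm_argmin f g F G c \<sigma> Thf Tg uk vk xk (fst p) (snd p)"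
      using argmin_unique[OF pos[OF pd], of uk vk xk] unfolding g_def
      by (intro ex1I[of _ "(u1, v1)"]) (auto simp: prod_eq_iff)
  next
    assume pd: "\<forall>w. w \<noteq> 0 \<longrightarrow> 0 < w \<bullet> ((1 / \<sigma>) *\<^sub>R Sf w + Tf w + F (adjoint F w))"
    obtain ua va xa where "(\<lambda>k. (u k, v k, x k)) \<longlonglongrightarrow> (ua, va, xa)" and k: "kkt ua va xa"
      using converges[OF pos[OF pd] kkt] by blast
    then show "\<exists>ua va xa. ((\<lambda>k. (u k, v k, x k)) \<longlonglongrightarrow> (ua, va, xa))
        \<and> solves_P f g F G c ua va \<and> solves_D f g F G c xa"
      using kkt_solves_P[OF k] kkt_solves_D[OF k] unfolding g_def by blast
  qed
qed

end
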